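(* Let $(\Omega,\mathcal{F},\mu)$ be an arbitrary (finite or infinite) $\sigma$-finite non-atomic measure space, let $(I,\mathcal{B}_m,m)$ be the corresponding standard measure space (so $m(I)=\mu(\Omega)$), and let $\mathbf{E}(I,\mathcal{B}_m,m)$ be a standard symmetric space. Put $$\mathbf{E}(\Omega,\mathcal{F},\mu):=\{f\in\mathbf{L}_0(\Omega,\mathcal{F},\mu):\ \xi_{f,\mu}\in\mathbf{E}(I,\mathcal{B}_m,m)\}$$ and $$\|f\|_{\mathbf{E}(\Omega,\mathcal{F},\mu)}:=\|\xi_{f,\mu}\|_{\mathbf{E}(I,\mathcal{B}_m,m)},\qquad f\in\mathbf{E}(\Omega,\mathcal{F},\mu).$$ Then $(\mathbf{E}(\Omega,\mathcal{F},\mu),\|\cdot\|_{\mathbf{E}(\Omega,\mathcal{F},\mu)})$ is a symmetric space on $(\Omega,\mathcal{F},\mu)$, and the symmetric spaces $\mathbf{E}(I,\mathcal{B}_m,m)$ and $\mathbf{E}(\Omega,\mathcal{F},\mu)$ are strictly equimeasurable.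
   Context: All measure spaces $(\Omega,\mathcal{F},\mu)$ are assumed $\mu$-complete, with finite or infinite $\sigma$-finite non-atomic measure $\mu$, $\mu(\Omega)>0$. $\mathbf{L}_0(\Omega,\mathcal{F},\mu)$ is the space of $\mu$-a.e. equivalence classes of measurable functions $f\colon\Omega\to\mathbb{R}$. The standard measure space corresponding to $(\Omega,\mathcal{F},\mu)$ is $(I,\mathcal{B}_m,m)$, where $I=[0,\infty)$ if $\mu(\Omega)=\infty$ and $I=[0,a]$ if $\mu(\Omega)=a<\infty$, $m$ is Lebesgue measure and $\mathcal{B}_m$ is the $m$-completion of the Borel $\sigma$-algebra of $I$. For $f\in\mathbf{L}_0(\Omega,\mathcal{F},\mu)$ the distribution function is $\eta_{f,\mu}(x)=\mu(\{|f|>x\})$, $x\ge 0$, and the decreasing rearrangement is $\xi_{f,\mu}(x)=\inf\{y\in[0,\infty):\eta_{f,\mu}(y)\le x\}$ (with $\inf\emptyset=+\infty$), considered as a function on $I$; when it is finite $m$-a.e. on $I$ it is regarded as an element of $\mathbf{L}_0(I,\mathcal{B}_m,m)$. A symmetric space on $(\Omega,\mathcal{F},\mu)$ is a non-zero Banach or quasi-Banach space $(\mathbf{E},\|\cdot\|_{\mathbf{E}})$ which is a linear subspace of $\mathbf{L}_0(\Omega,\mathcal{F},\mu)$ such that: (1) if $f\in\mathbf{L}_0$, $g\in\mathbf{E}$ and $|f|\le|g|$, then $f\in\mathbf{E}$ and $\|f\|_{\mathbf{E}}\le\|g\|_{\mathbf{E}}$; (2) if $f\in\mathbf{L}_0$,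 $g\in\mathbf{E}$ and $\eta_{f,\mu}=\eta_{g,\mu}$, then $f\in\mathbf{E}$ and $\|f\|_{\mathbf{E}}=\|g\|_{\mathbf{E}}$. It is called standard if its underlying measure space is a standard one $(I,\mathcal{B}_m,m)$. For a symmetric space $\mathbf{E}=\mathbf{E}(\Omega,\mathcal{F},\mu)$ let $\Xi(\mathbf{E})=\{\xi_{f,\mu}\in\mathbf{L}_0(I,\mathcal{B}_m,m): f\in\mathbf{E}\}$ and $\|\xi_{f,\mu}\|_{\Xi(\mathbf{E})}=\|f\|_{\mathbf{E}}$ for $f\in\mathbf{E}$. Symmetric spaces $\mathbf{E}_1,\mathbf{E}_2$ (on possibly different measure spaces) are equimeasurable if $\Xi(\mathbf{E}_1)=\Xi(\mathbf{E}_2)$, and strictly equimeasurable if in addition $\|\cdot\|_{\Xi(\mathbf{E}_1)}=\|\cdot\|_{\Xi(\mathbf{E}_2)}$. *)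

theory Defs
  imports "HOL-Analysis.Analysis"
begin

definition nonatomic :: "'a measure \<Rightarrow> bool" where
  "nonatomic M \<longleftrightarrow>
    (\<forall>A\<in>sets M. 0 < emeasure M A \<longrightarrow>
      (\<exists>B\<in>sets M. B \<subseteq> A \<and> 0 < emeasure M B \<and> emeasure M B < emeasure M A))"

definition std_interval :: "'a measure \<Rightarrow> real set" where
  "std_interval M =
    (if emeasure M (space M) = \<infinity> then {0..} else {0..measure M (space M)})"

definition std_space :: "'a measure \<Rightarrow> real measure" where
  "std_space M = lebesgue_on (std_interval M)"


(* Elements of L0 are equivalence classes of functions. Values outside space M are irrelevant
   to both measurability and almost-everywhere equality. *)

definition ae_eq :: "'a measure \<Rightarrow> (('a \<Rightarrow> real) \<times> ('a \<Rightarrow> real)) set" where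
  "ae_eq M = {(f, g). f \<in> borel_measurable M \<and> g \<in> borel_measurable M \<and> (AE x in M. f x = g x)}"

definition L0 :: "'a measure \<Rightarrow> ('a \<Rightarrow> real) set set" where
  "L0 M = borel_measurable M // ae_eq M"

(* The class of a non-measurable function is empty, hence not an element of L0 M. *)

definition ae_class :: "'a measure \<Rightarrow> ('a \<Rightarrow> real) \<Rightarrow> ('a \<Rightarrow> real) set" where
  "ae_class M f = ae_eq M `` {f}"

definition distr_fun :: "'a measure \<Rightarrow> ('a \<Rightarrow> real) \<Rightarrow> real \<Rightarrow> ennreal" where
  "distr_fun M f x = emeasure M {\<omega> \<in> space M. x < \<bar>f \<omega>\<bar>}"

(* In ereal the infimum of the empty set is \<infinity>. *)

definition rearrangement :: "'a measure \<Rightarrow> ('a \<Rightarrow> real) \<Rightarrow> real \<Rightarrow> ereal" where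
  "rearrangement M f t = Inf (ereal ` {y. 0 \<le> y \<and> distr_fun M f y \<le> ennreal t})"

(* The rearrangement of an element A of L0 M, as an element of L0 (std_space M). All
   representatives f of A have the same rearrangement. If it is not finite almost everywhere,
   no real function g qualifies and the result is {}, which is not an element of
   L0 (std_space M). *)

definition rearr_class :: "'a measure \<Rightarrow> ('a \<Rightarrow> real) set \<Rightarrow> (real \<Rightarrow> real) set" where
  "rearr_class M A =
    {g \<in> borel_measurable (std_space M).
      \<exists>f\<in>A. AE t in std_space M. ereal (g t) = rearrangement M f t}"


definition L0_subspace :: "'a measure \<Rightarrow> ('a \<Rightarrow> real) set set \<Rightarrow> bool" where
  "L0_subspace M E \<longleftrightarrow>
    E \<subseteq> L0 M \<and>
    ae_class M (\<lambda>x. 0) \<in> E \<and>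
    (\<forall>f g. ae_class M f \<in> E \<longrightarrow> ae_class M g \<in> E \<longrightarrow> ae_class M (\<lambda>x. f x + g x) \<in> E) \<and>
    (\<forall>c f. ae_class M f \<in> E \<longrightarrow> ae_class M (\<lambda>x. c * f x) \<in> E)"

(* K is the constant in the triangle inequality: K = 1 gives norms. *)

definition quasi_norm_on ::
    "'a measure \<Rightarrow> ('a \<Rightarrow> real) set set \<Rightarrow> (('a \<Rightarrow> real) set \<Rightarrow> real) \<Rightarrow> real \<Rightarrow> bool" where
  "quasi_norm_on M E N K \<longleftrightarrow>
    (\<forall>A\<in>E. 0 \<le> N A) \<and>
    (\<forall>A\<in>E. N A = 0 \<longleftrightarrow> A = ae_class M (\<lambda>x. 0)) \<and>
    (\<forall>c f. ae_class M f \<in> E \<longrightarrow> N (ae_class M (\<lambda>x. c * f x)) = \<bar>c\<bar> * N (ae_class M f)) \<and>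
    (\<forall>f g. ae_class M f \<in> E \<longrightarrow> ae_class M g \<in> E \<longrightarrow>
      N (ae_class M (\<lambda>x. f x + g x)) \<le> K * (N (ae_class M f) + N (ae_class M g)))"

definition complete_on ::
    "'a measure \<Rightarrow> ('a \<Rightarrow> real) set set \<Rightarrow> (('a \<Rightarrow> real) set \<Rightarrow> real) \<Rightarrow> bool" where
  "complete_on M E N \<longleftrightarrow>
    (\<forall>u :: nat \<Rightarrow> 'a \<Rightarrow> real.
      (\<forall>n. ae_class M (u n) \<in> E) \<longrightarrow>
      (\<forall>e>0. \<exists>k. \<forall>m\<ge>k. \<forall>n\<ge>k. N (ae_class M (\<lambda>x. u m x - u n x)) < e) \<longrightarrow>
      (\<exists>f. ae_class M f \<in> E \<and> (\<lambda>n. N (ae_class M (\<lambda>x. u n x - f x))) \<longlonglongrightarrow> 0))"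

definition banach_on ::
    "'a measure \<Rightarrow> ('a \<Rightarrow> real) set set \<Rightarrow> (('a \<Rightarrow> real) set \<Rightarrow> real) \<Rightarrow> bool" where
  "banach_on M E N \<longleftrightarrow> L0_subspace M E \<and> quasi_norm_on M E N 1 \<and> complete_on M E N"

definition quasi_banach_on ::
    "'a measure \<Rightarrow> ('a \<Rightarrow> real) set set \<Rightarrow> (('a \<Rightarrow> real) set \<Rightarrow> real) \<Rightarrow> bool" where
  "quasi_banach_on M E N \<longleftrightarrow>
    L0_subspace M E \<and> (\<exists>K\<ge>1. quasi_norm_on M E N K) \<and> complete_on M E N"

definition symmetric_space ::
    "'a measure \<Rightarrow> ('a \<Rightarrow> real) set set \<Rightarrow> (('a \<Rightarrow> real) set \<Rightarrow> real) \<Rightarrow> bool" where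
  "symmetric_space M E N \<longleftrightarrow>
    (banach_on M E N \<or> quasi_banach_on M E N) \<and>
    E \<noteq> {ae_class M (\<lambda>x. 0)} \<and>
    (\<forall>f g. f \<in> borel_measurable M \<longrightarrow> ae_class M g \<in> E \<longrightarrow> (AE x in M. \<bar>f x\<bar> \<le> \<bar>g x\<bar>) \<longrightarrow>
      ae_class M f \<in> E \<and> N (ae_class M f) \<le> N (ae_class M g)) \<and>
    (\<forall>f g. f \<in> borel_measurable M \<longrightarrow> ae_class M g \<in> E \<longrightarrow>
      (\<forall>x\<ge>0. distr_fun M f x = distr_fun M g x) \<longrightarrow>
      ae_class M f \<in> E \<and> N (ae_class M f) = N (ae_class M g))"


definition Xi :: "'a measure \<Rightarrow> ('a \<Rightarrow> real) set set \<Rightarrow> (real \<Rightarrow> real) set set" where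
  "Xi M E = rearr_class M ` E \<inter> L0 (std_space M)"

(* Unambiguous when (E, N) is symmetric, since N then depends only on the rearrangement. *)

definition Xi_norm ::
    "'a measure \<Rightarrow> ('a \<Rightarrow> real) set set \<Rightarrow> (('a \<Rightarrow> real) set \<Rightarrow> real) \<Rightarrow> (real \<Rightarrow> real) set \<Rightarrow> real" where
  "Xi_norm M E N h = (THE r. \<exists>A\<in>E. rearr_class M A = h \<and> r = N A)"

definition equimeasurable ::
    "'a measure \<Rightarrow> ('a \<Rightarrow> real) set set \<Rightarrow> 'b measure \<Rightarrow> ('b \<Rightarrow> real) set set \<Rightarrow> bool" where
  "equimeasurable M1 E1 M2 E2 \<longleftrightarrow> Xi M1 E1 = Xi M2 E2"

definition strictly_equimeasurable ::
    "'a measure \<Rightarrow> ('a \<Rightarrow> real) set set \<Rightarrow> (('a \<Rightarrow> real) set \<Rightarrow> real) \<Rightarrow>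
     'b measure \<Rightarrow> ('b \<Rightarrow> real) set set \<Rightarrow> (('b \<Rightarrow> real) set \<Rightarrow> real) \<Rightarrow> bool" where
  "strictly_equimeasurable M1 E1 N1 M2 E2 N2 \<longleftrightarrow>
    equimeasurable M1 E1 M2 E2 \<and>
    (\<forall>h\<in>Xi M1 E1. Xi_norm M1 E1 N1 h = Xi_norm M2 E2 N2 h)"


definition transfer_space :: "'a measure \<Rightarrow> (real \<Rightarrow> real) set set \<Rightarrow> ('a \<Rightarrow> real) set set" where
  "transfer_space M E = {A \<in> L0 M. rearr_class M A \<in> E}"

definition transfer_norm ::
    "'a measure \<Rightarrow> ((real \<Rightarrow> real) set \<Rightarrow> real) \<Rightarrow> ('a \<Rightarrow> real) set \<Rightarrow> real" where
  "transfer_norm M N A = N (rearr_class M A)"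

end

theory Submission
  imports Defs
begin

text \<open>Write \<open>f\<^sup>*\<close> for the rearrangement of \<open>f\<close>. A symmetric space need only be quasi-Banach, so the
  constant in the triangle inequality may grow on the way from the interval to the given measure
  space. Hence no joint distributions are needed: with \<open>c\<^sub>k\<close> summing to at most 1, the
  rearrangement of \<open>\<Sum> |f\<^sub>k|\<close> at \<open>t\<close> is at most \<open>\<Sum> f\<^sub>k\<^sup>*(c\<^sub>k t)\<close>, dilations are bounded on the standard
  space, and the Riesz-Fischer argument there bounds the sum. This one estimate gives both the
  triangle inequality and completeness. Conversely, by Sierpinski's theorem a nonatomic space
  contains a decreasing family of sets with the measures prescribed by a distribution function, so
  every element of the standard space is equidistributed with a function on the given space.\<close>

section \<open>Distribution functions and rearrangements\<close>

text \<open>Summable weights \<open>c\<^sub>k\<close> force dilations by unbounded factors, and the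
  bounds on their norms grow geometrically with k. The series estimate therefore covers only
  sequences whose norms decay faster than this growth. That is enough: a finite sum is padded with
  zeros, and a Cauchy sequence has subsequences with increments as small as desired. The usual bound
  for a dilation, by adding disjoint equidistributed copies, needs room that a finite interval may
  not have. Splitting by the parity of the dyadic shell needs none: each parity class misses more
  than an eighth of any interval from 0 to s, whence the factor 7/8. The exponent 6 is the least
  with (7/8)^6 \<le> 1/2. If K is the triangle constant on the interval, each dilation by 8/7 costs
  2 K, so term k pays (2 K)^(6(k+1)), and the Riesz-Fischer argument asks for a further (2 K)^(k+1);
  hence the ratio (2 K)^7.\<close>

lemma ae_class_eq_iff:
  assumes "f \<in> borel_measurable M" "g \<in> borel_measurable M"
  shows "ae_class M f = ae_class M g \<longleftrightarrow> (AE x in M. f x = g x)"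
proof
  assume "ae_class M f = ae_class M g"
  moreover have "g \<in> ae_class M g" using assms by (simp add: ae_class_def ae_eq_def)
  ultimately have "g \<in> ae_class M f" by simp
  then show "AE x in M. f x = g x" by (simp add: ae_class_def ae_eq_def)
next
  assume ae: "AE x in M. f x = g x"
  have "(AE x in M. f x = h x) \<longleftrightarrow> (AE x in M. g x = h x)" for h
    using ae by (auto elim: eventually_elim2)
  then show "ae_class M f = ae_class M g"
    using assms by (auto simp: ae_class_def ae_eq_def)
qed

text \<open>A class in the quotient contains its generator, while a non-measurable function has the
  empty class. So \<open>ae_class M f \<in> E\<close> alone will carry the measurability of
  \<open>f\<close>.\<close>

lemma ae_class_in_L0_iff: "ae_class M f \<in> L0 M \<longleftrightarrow> f \<in> borel_measurable M"
proof
  assume "f \<in> borel_measurable M"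
  then show "ae_class M f \<in> L0 M" by (auto simp: L0_def ae_class_def quotient_def)
next
  assume "ae_class M f \<in> L0 M"
  then obtain g where g: "g \<in> borel_measurable M" "ae_eq M `` {f} = ae_eq M `` {g}"
    by (auto simp: L0_def ae_class_def quotient_def)
  then have "g \<in> ae_eq M `` {f}" by (simp add: ae_eq_def)
  then show "f \<in> borel_measurable M" by (simp add: ae_eq_def)
qed

lemma L0_E:
  assumes "A \<in> L0 M"
  obtains f where "f \<in> borel_measurable M" "A = ae_class M f"
  using assms by (auto simp: L0_def ae_class_def quotient_def)

lemma distr_fun_antimono:
  assumes "f \<in> borel_measurable M" "x \<le> y"
  shows "distr_fun M f y \<le> distr_fun M f x"
  unfolding distr_fun_def using assms by (intro emeasure_mono) auto

lemma distr_fun_mono_AE: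
  assumes "f \<in> borel_measurable M" "g \<in> borel_measurable M" "AE x in M. \<bar>f x\<bar> \<le> \<bar>g x\<bar>"
  shows "distr_fun M f y \<le> distr_fun M g y"
  unfolding distr_fun_def using assms by (intro emeasure_mono_AE) (auto elim: eventually_mono)

lemma distr_fun_cong_AE:
  assumes "f \<in> borel_measurable M" "g \<in> borel_measurable M" "AE x in M. f x = g x"
  shows "distr_fun M f y = distr_fun M g y"
  using assms by (intro antisym distr_fun_mono_AE) (auto elim: eventually_mono)

lemma distr_fun_le_space: "distr_fun M f y \<le> emeasure M (space M)"
  unfolding distr_fun_def by (rule emeasure_space)

lemma distr_fun_cmult:
  assumes "c \<noteq> 0"
  shows "distr_fun M (\<lambda>x. c * f x) y = distr_fun M f (y / \<bar>c\<bar>)"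
  using assms by (simp add: distr_fun_def abs_mult pos_divide_less_eq mult.commute)

text \<open>Continuity from below needs no finiteness, so the threshold form with \<open>v\<close>
  also covers points where the distribution function is infinite.\<close>

lemma distr_fun_right_continuous:
  assumes [measurable]: "f \<in> borel_measurable M" and "v < distr_fun M f y"
  obtains z where "y < z" "v < distr_fun M f z"
proof -
  have "incseq (\<lambda>n::nat. {\<omega> \<in> space M. y + 1 / Suc n < \<bar>f \<omega>\<bar>})"
  proof (rule incseq_SucI, safe)
    fix n \<omega> assume "y + 1 / real (Suc n) < \<bar>f \<omega>\<bar>"
    moreover have "1 / real (Suc (Suc n)) \<le> 1 / real (Suc n)" by (simp add: field_simps)
    ultimately show "y + 1 / real (Suc (Suc n)) < \<bar>f \<omega>\<bar>" by linarith
  qed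
  then have "(SUP n. distr_fun M f (y + 1 / Suc n))
      = emeasure M (\<Union>n::nat. {\<omega> \<in> space M. y + 1 / Suc n < \<bar>f \<omega>\<bar>})"
    unfolding distr_fun_def by (intro SUP_emeasure_incseq) auto
  also have "(\<Union>n::nat. {\<omega> \<in> space M. y + 1 / Suc n < \<bar>f \<omega>\<bar>}) = {\<omega> \<in> space M. y < \<bar>f \<omega>\<bar>}"
  proof safe
    fix \<omega> and n :: nat assume "y + 1 / real (Suc n) < \<bar>f \<omega>\<bar>"
    moreover have "0 < 1 / real (Suc n)" by simp
    ultimately show "y < \<bar>f \<omega>\<bar>" by linarith
  next
    fix \<omega> assume *: "\<omega> \<in> space M" "y < \<bar>f \<omega>\<bar>"
    then obtain n where "inverse (real (Suc n)) < \<bar>f \<omega>\<bar> - y"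
      using reals_Archimedean[of "\<bar>f \<omega>\<bar> - y"] by auto
    with * show "\<omega> \<in> (\<Union>n::nat. {\<omega> \<in> space M. y + 1 / Suc n < \<bar>f \<omega>\<bar>})"
      by (auto simp: inverse_eq_divide algebra_simps intro!: exI[of _ n])
  qed
  finally have "v < (SUP n. distr_fun M f (y + 1 / Suc n))"
    using assms(2) by (simp add: distr_fun_def)
  then obtain n :: nat where "v < distr_fun M f (y + 1 / Suc n)"
    by (auto simp: less_SUP_iff)
  then show thesis by (intro that[of "y + 1 / Suc n"]) auto
qed

text \<open>Right continuity makes the infimum attained. This Galois connection replaces the infimum
  in the later estimates.\<close>

lemma rearrangement_le_iff:
  assumes [measurable]: "f \<in> borel_measurable M" and "0 \<le> y"
  shows "rearrangement M f t \<le> ereal y \<longleftrightarrow> distr_fun M f y \<le> ennreal t"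
proof
  assume "distr_fun M f y \<le> ennreal t"
  then show "rearrangement M f t \<le> ereal y"
    unfolding rearrangement_def using assms by (intro Inf_lower) auto
next
  assume *: "rearrangement M f t \<le> ereal y"
  show "distr_fun M f y \<le> ennreal t"
  proof (rule ccontr)
    assume "\<not> ?thesis"
    then obtain z where z: "y < z" "ennreal t < distr_fun M f z"
      by (metis distr_fun_right_continuous assms(1) not_le)
    have "ereal z \<le> rearrangement M f t"
      unfolding rearrangement_def
    proof (rule Inf_greatest, clarsimp)
      fix w assume "0 \<le> w" "distr_fun M f w \<le> ennreal t"
      then show "z \<le> w" using z distr_fun_antimono[OF assms(1), of w z] by force
    qed
    with * have "ereal z \<le> ereal y" by (rule order_trans[rotated])
    then show False using z by simp
  qed
qed

lemma rearrangement_nonneg: "0 \<le> rearrangement M f t"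
  unfolding rearrangement_def by (rule Inf_greatest) auto

lemma rearrangement_cong:
  assumes "\<And>y. 0 \<le> y \<Longrightarrow> distr_fun M f y = distr_fun M' g y"
  shows "rearrangement M f = rearrangement M' g"
  unfolding rearrangement_def fun_eq_iff using assms by (auto intro!: arg_cong[of _ _ Inf] image_cong)

lemma borel_measurable_rearrangement [measurable]:
  assumes "f \<in> borel_measurable M"
  shows "rearrangement M f \<in> borel_measurable borel"
proof (rule borel_measurableI_greater)
  fix y :: ereal
  show "{t \<in> space borel. y < rearrangement M f t} \<in> sets borel"
  proof (cases "0 \<le> y \<and> y \<noteq> \<infinity>")
    case True
    then obtain r where r: "y = ereal r" "0 \<le> r" by (cases y) auto
    have "{t \<in> space borel. y < rearrangement M f t} = {t. ennreal t < distr_fun M f r}"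
      using rearrangement_le_iff[OF assms r(2)] by (auto simp: r not_le[symmetric])
    then show ?thesis by simp
  next
    case False
    then have "{t \<in> space borel. y < rearrangement M f t} \<in> {{}, UNIV}"
      using less_le_trans[OF _ rearrangement_nonneg] by (auto simp: not_le)
    then show ?thesis by auto
  qed
qed

text \<open>That is, \<open>f\<close> is bounded off a set of finite measure. Then the rearrangement
  is finite at every t > 0; otherwise it is infinite everywhere.\<close>

definition fin_rearr :: "'a measure \<Rightarrow> ('a \<Rightarrow> real) \<Rightarrow> bool" where
  "fin_rearr M f \<longleftrightarrow> (\<exists>y\<ge>0. distr_fun M f y < \<infinity>)"

lemma distr_fun_tendsto_0:
  assumes [measurable]: "f \<in> borel_measurable M" and "fin_rearr M f"
  shows "(\<lambda>n. distr_fun M f (real n)) \<longlonglongrightarrow> 0"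
proof -
  obtain y where y: "0 \<le> y" "distr_fun M f y < \<infinity>"
    using assms(2) by (auto simp: fin_rearr_def)
  obtain k :: nat where k: "y \<le> real k" using real_arch_simple by blast
  \<comment> \<open>Continuity from above needs finite measures, hence the shift by \<open>k\<close>
    past \<open>y\<close>.\<close>
  have fin: "distr_fun M f (real n + real k) \<noteq> \<infinity>" for n
    using distr_fun_antimono[OF assms(1), of y "real n + real k"] y k by auto
  let ?A = "\<lambda>n::nat. {\<omega> \<in> space M. real n + real k < \<bar>f \<omega>\<bar>}"
  have "(\<lambda>n. emeasure M (?A n)) \<longlonglongrightarrow> emeasure M (\<Inter>n. ?A n)"
    using fin by (intro Lim_emeasure_decseq decseq_SucI) (auto simp: distr_fun_def)
  moreover have "(\<Inter>n. ?A n) = {}"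
  proof -
    { fix \<omega>
      obtain n :: nat where "\<bar>f \<omega>\<bar> \<le> real n" using real_arch_simple by blast
      then have "\<omega> \<notin> ?A n" by auto
      then have "\<omega> \<notin> (\<Inter>n. ?A n)" by blast }
    then show ?thesis by blast
  qed
  ultimately have "(\<lambda>n. distr_fun M f (real (n + k))) \<longlonglongrightarrow> 0"
    by (simp add: distr_fun_def)
  then show ?thesis by (rule LIMSEQ_offset)
qed

lemma rearrangement_finite:
  assumes [measurable]: "f \<in> borel_measurable M" and "fin_rearr M f" "0 < t"
  shows "rearrangement M f t < \<infinity>"
proof -
  have "eventually (\<lambda>n. distr_fun M f (real n) < ennreal t) sequentially"
    using distr_fun_tendsto_0[OF assms(1,2)] assms(3) by (intro order_tendstoD) auto
  then obtain n where "distr_fun M f (real n) \<le> ennreal t"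
    by (auto simp: eventually_sequentially intro: less_imp_le)
  then have "rearrangement M f t \<le> ereal (real n)"
    by (subst rearrangement_le_iff) auto
  then show ?thesis by auto
qed

text \<open>At 0, where the rearrangement of an unbounded function is infinite, the value is \<open>real_of_ereal \<infinity> = 0\<close>.\<close>

definition rearr :: "'a measure \<Rightarrow> ('a \<Rightarrow> real) \<Rightarrow> real \<Rightarrow> real" where
  "rearr M f t = real_of_ereal (rearrangement M f t)"

lemma rearr_nonneg: "0 \<le> rearr M f t"
  by (simp add: rearr_def rearrangement_nonneg real_of_ereal_pos)

lemma ereal_rearr:
  assumes "f \<in> borel_measurable M" "fin_rearr M f" "0 < t"
  shows "ereal (rearr M f t) = rearrangement M f t"
  using rearrangement_finite[OF assms] rearrangement_nonneg[of M f t]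
  unfolding rearr_def by (intro ereal_real') auto

lemma rearr_le_iff:
  assumes "f \<in> borel_measurable M" "fin_rearr M f" "0 < t" "0 \<le> y"
  shows "rearr M f t \<le> y \<longleftrightarrow> distr_fun M f y \<le> ennreal t"
  using rearrangement_le_iff[OF assms(1,4), of t] ereal_rearr[OF assms(1-3)] by (metis ereal_less_eq(3))

lemma borel_measurable_rearr:
  assumes [measurable]: "f \<in> borel_measurable M"
  shows "rearr M f \<in> borel_measurable borel"
  unfolding rearr_def by measurable

section \<open>Initial intervals of the standard space\<close>

lemma space_std_space: "space (std_space M) = std_interval M"
  by (simp add: std_space_def space_restrict_space)

lemma std_interval_lebesgue: "std_interval M \<in> sets lebesgue"
  by (simp add: std_interval_def)

lemma borel_measurable_std_space:
  assumes "f \<in> borel_measurable borel"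
  shows "f \<in> borel_measurable (std_space M)"
  unfolding std_space_def using assms
  by (intro measurable_restrict_space1 measurable_completion) simp

lemma emeasure_std_space:
  assumes "A \<subseteq> std_interval M"
  shows "emeasure (std_space M) A = emeasure lebesgue A"
  unfolding std_space_def using assms std_interval_lebesgue[of M]
  by (intro emeasure_restrict_space) auto

lemma emeasure_lebesgue_atLeast: "emeasure lebesgue {0::real..} = \<infinity>"
proof -
  have "ennreal (real n) \<le> emeasure lebesgue {0::real..}" for n :: nat
  proof -
    have "emeasure lebesgue {0..real n} \<le> emeasure lebesgue {0::real..}"
      by (intro emeasure_mono) auto
    then show ?thesis by simp
  qed
  then show ?thesis
    by (metis ennreal_Ex_less_of_nat ennreal_of_nat_eq_real_of_nat infinity_ennreal_def leD top.not_eq_extremum)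
qed

text \<open>Superlevel sets of decreasing functions are initial intervals, so this computes their
  distribution functions; the minimum appears because the interval ends at the total
  measure.\<close>

lemma emeasure_std_lessThan:
  "emeasure (std_space M) {t \<in> std_interval M. ennreal t < v} = min v (emeasure M (space M))"
proof (cases "emeasure M (space M) = \<infinity>")
  case True
  then have I: "std_interval M = {0..}" by (simp add: std_interval_def)
  show ?thesis
  proof (cases v)
    case (real s)
    then have "{t \<in> std_interval M. ennreal t < v} = {0..<s}"
      by (auto simp: I ennreal_less_iff)
    then show ?thesis using True real by (subst emeasure_std_space) auto
  next
    case top
    then have "{t \<in> std_interval M. ennreal t < v} = {0..}" by (auto simp: I)
    then show ?thesis using True top I emeasure_lebesgue_atLeast
      by (subst emeasure_std_space) auto
  qed
next
  case False
  define r where "r = measure M (space M)"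
  have r: "emeasure M (space M) = ennreal r" "0 \<le> r"
    using False by (auto simp: r_def emeasure_eq_ennreal_measure)
  have I: "std_interval M = {0..r}" using False by (simp add: std_interval_def r_def)
  show ?thesis
  proof (cases "v \<le> ennreal r")
    case True
    then obtain s where s: "v = ennreal s" "0 \<le> s" "s \<le> r"
      using r by (cases v) (auto simp: top_unique)
    then have "{t \<in> std_interval M. ennreal t < v} = {0..<s}"
      by (auto simp: I ennreal_less_iff)
    moreover have "emeasure (std_space M) {0..<s} = ennreal s"
      using s by (subst emeasure_std_space) (auto simp: I)
    ultimately show ?thesis using True unfolding r by (simp add: s min_absorb1)
  next
    case False
    have "ennreal t < v" if "t \<le> r" for t
      using False le_less_trans[OF ennreal_leI[OF that]] by (simp add: not_le)
    then have "{t \<in> std_interval M. ennreal t < v} = {0..r}" by (auto simp: I)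
    moreover have "emeasure (std_space M) {0..r} = ennreal r"
      using r by (subst emeasure_std_space) (auto simp: I)
    ultimately show ?thesis using False unfolding r by (simp add: min_absorb2)
  qed
qed

lemma emeasure_std_space_space: "emeasure (std_space M) (space (std_space M)) = emeasure M (space M)"
proof -
  have "{t \<in> std_interval M. ennreal t < \<infinity>} = space (std_space M)" by (auto simp: space_std_space)
  then show ?thesis using emeasure_std_lessThan[of M \<infinity>] by simp
qed

lemma borel_std_space_sets:
  assumes "A \<in> sets borel"
  shows "{t \<in> std_interval M. t \<in> A} \<in> sets (std_space M)"
proof -
  have "A \<in> sets lebesgue" using assms by (intro sets_completionI_sets) simp
  then have "std_interval M \<inter> A \<in> sets (std_space M)"
    unfolding std_space_def sets_restrict_space by (rule imageI)
  then show ?thesis by (simp add: Int_def)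
qed

text \<open>Discards the point 0, where \<open>rearr\<close> and \<open>rearrangement\<close> may
  disagree.\<close>

lemma AE_std_space_pos: "AE t in std_space M. 0 < t"
proof (rule AE_I)
  show "{t \<in> space (std_space M). \<not> 0 < t} \<subseteq> {0} \<inter> std_interval M"
    by (auto simp: space_std_space std_interval_def split: if_splits)
  show "{0} \<inter> std_interval M \<in> sets (std_space M)"
    using borel_std_space_sets[of "{0}" M] by (simp add: Int_def conj_commute)
  show "emeasure (std_space M) ({0} \<inter> std_interval M) = 0"
    by (subst emeasure_std_space) (auto simp: Int_insert_left)
qed

lemma less_dilation_iff:
  assumes "0 < c" "0 < t"
  shows "ennreal t < ennreal (1 / c) * v \<longleftrightarrow> ennreal (c * t) < v"
proof (cases v)
  case (real r)
  have "t < r / c \<longleftrightarrow> c * t < r" using \<open>0 < c\<close> by (simp add: pos_less_divide_eq mult.commute)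
  then show ?thesis using real assms by (simp add: ennreal_mult'[symmetric] ennreal_less_iff)
next
  case top
  then show ?thesis using \<open>0 < c\<close> by (simp add: ennreal_mult_top)
qed

text \<open>By the Galois connection, \<open>rearr M f (c * t)\<close> exceeds \<open>y\<close>
  exactly on an initial interval of length \<open>distr_fun M f y\<close> divided by
  \<open>c\<close>, cut off where the standard interval of \<open>M'\<close> ends.\<close>

lemma distr_fun_rearr_dilation:
  assumes f: "f \<in> borel_measurable M" "fin_rearr M f" and "0 \<le> y" "0 < c"
  shows "distr_fun (std_space M') (\<lambda>t. rearr M f (c * t)) y
      = min (ennreal (1 / c) * distr_fun M f y) (emeasure M' (space M'))"
proof -
  have [measurable]: "(\<lambda>t. rearr M f (c * t)) \<in> borel_measurable (std_space M')"
    by (intro borel_measurable_std_space measurable_compose[OF _ borel_measurable_rearr[OF f(1)]]) simp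
  have "AE t in std_space M'. t \<in> {t \<in> space (std_space M'). y < \<bar>rearr M f (c * t)\<bar>}
      \<longleftrightarrow> t \<in> {t \<in> std_interval M'. ennreal t < ennreal (1 / c) * distr_fun M f y}"
    using AE_std_space_pos
  proof eventually_elim
    case (elim t)
    then show ?case
      using rearr_le_iff[OF f mult_pos_pos[OF \<open>0 < c\<close> elim] \<open>0 \<le> y\<close>] less_dilation_iff[OF \<open>0 < c\<close> elim, of "distr_fun M f y"]
      by (auto simp: rearr_nonneg space_std_space not_le[symmetric])
  qed
  moreover have "{t \<in> std_interval M'. ennreal t < ennreal (1 / c) * distr_fun M f y} \<in> sets (std_space M')"
    using borel_std_space_sets[of "{t. ennreal t < ennreal (1 / c) * distr_fun M f y}" M'] by simp
  ultimately show ?thesis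
    unfolding distr_fun_def emeasure_std_lessThan[symmetric]
    by (intro emeasure_eq_AE) (auto simp: distr_fun_def)
qed

lemma distr_fun_rearr:
  assumes "f \<in> borel_measurable M" "fin_rearr M f" "0 \<le> y"
    and "emeasure M (space M) = emeasure M' (space M')"
  shows "distr_fun (std_space M') (rearr M f) y = distr_fun M f y"
  using distr_fun_rearr_dilation[OF assms(1-3), of 1 M'] distr_fun_le_space[of M f y] assms(4)
  by (simp add: min_absorb1)

text \<open>The second measure \<open>M'\<close> allows two uses: \<open>M\<close> equal to
  \<open>M'\<close>, and \<open>M\<close> equal to the standard space of \<open>M'\<close>.\<close>

lemma rearr_class_ae_class:
  assumes f: "f \<in> borel_measurable M" "fin_rearr M f"
    and eq: "std_space M = std_space M'"
  shows "rearr_class M (ae_class M f) = ae_class (std_space M') (rearr M f)"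
proof -
  have 1: "rearrangement M f' = rearrangement M f" if "f' \<in> ae_class M f" for f'
    using that f by (intro rearrangement_cong distr_fun_cong_AE) (auto simp: ae_class_def ae_eq_def elim: eventually_mono)
  have 2: "f \<in> ae_class M f" using f by (simp add: ae_class_def ae_eq_def)
  have 3: "(AE t in std_space M'. ereal (g t) = rearrangement M f t)
      \<longleftrightarrow> (AE t in std_space M'. rearr M f t = g t)" for g
  proof (rule eventually_subst)
    show "AE t in std_space M'. (ereal (g t) = rearrangement M f t) = (rearr M f t = g t)"
      using AE_std_space_pos by eventually_elim (auto simp: ereal_rearr[OF f, symmetric])
  qed
  have "(\<exists>f'\<in>ae_class M f. AE t in std_space M'. ereal (g t) = rearrangement M f' t)
      \<longleftrightarrow> (AE t in std_space M'. ereal (g t) = rearrangement M f t)" for g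
    using 2 by (auto dest: 1)
  then have "rearr_class M (ae_class M f) =
      {g \<in> borel_measurable (std_space M'). AE t in std_space M'. ereal (g t) = rearrangement M f t}"
    unfolding rearr_class_def eq by simp
  then show ?thesis
    unfolding 3 using borel_measurable_std_space[OF borel_measurable_rearr[OF f(1)]]
    by (auto simp: ae_class_def ae_eq_def)
qed

section \<open>Functions on a nonatomic space with a given distribution\<close>

text \<open>Nonatomicity first yields a subset of strictly smaller, hence finite, measure. Splitting
  it repeatedly and keeping the smaller piece at least halves the measure each time.\<close>

lemma nonatomic_small_subset:
  assumes "nonatomic M" and A: "A \<in> sets M" "0 < emeasure M A" and "0 < (e::ennreal)"
  obtains B where "B \<in> sets M" "B \<subseteq> A" "0 < emeasure M B" "emeasure M B < e"
proof -
  obtain A0 where A0: "A0 \<in> sets M" "A0 \<subseteq> A" "0 < emeasure M A0" "emeasure M A0 < emeasure M A"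
    using assms by (auto simp: nonatomic_def)
  then have fin: "emeasure M A0 < \<infinity>" by (metis infinity_ennreal_def less_le_trans top_greatest)
  have halve: "\<exists>B\<in>sets M. B \<subseteq> A0 \<and> 0 < measure M B \<and> measure M B * 2 ^ n \<le> measure M A0" for n :: nat
  proof (induction n)
    case 0
    then show ?case using A0 fin by (intro bexI[of _ A0]) (auto simp: measure_def enn2real_positive_iff)
  next
    case (Suc n)
    then obtain B where B: "B \<in> sets M" "B \<subseteq> A0" "0 < measure M B" "measure M B * 2 ^ n \<le> measure M A0"
      by blast
    have "emeasure M B < \<infinity>" using B A0 fin emeasure_mono[of B A0 M] by (auto simp: le_less_trans)
    then have B': "B \<in> fmeasurable M" using B by (simp add: fmeasurable_def)
    have "0 < emeasure M B" using B by (simp add: measure_def enn2real_positive_iff)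
    then obtain C where C: "C \<in> sets M" "C \<subseteq> B" "0 < emeasure M C" "emeasure M C < emeasure M B"
      using assms(1) B by (auto simp: nonatomic_def)
    have C': "C \<in> fmeasurable M" using fmeasurableI2[OF B' C(2,1)] .
    have "0 < measure M C" "measure M C < measure M B"
      using C emeasure_eq_measure2[OF C'] emeasure_eq_measure2[OF B'] by (auto simp: ennreal_less_iff)
    moreover have "measure M (B - C) = measure M B - measure M C"
      using B' C' C by (intro measurable_measure_Diff) auto
    ultimately consider "measure M C \<le> measure M B / 2" "0 < measure M C"
      | "measure M (B - C) \<le> measure M B / 2" "0 < measure M (B - C)"
      by fastforce
    then obtain D where D: "D \<in> sets M" "D \<subseteq> B" "0 < measure M D" "measure M D \<le> measure M B / 2"
      using B C by cases (blast intro: sets.Diff)+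
    have "measure M D * 2 ^ Suc n \<le> measure M B * 2 ^ n" using D(4) by simp
    also note B(4)
    finally show ?case using D B by (intro bexI[of _ D]) auto
  qed
  obtain r where r: "0 < r" "ennreal r \<le> e"
    using \<open>0 < e\<close> by (cases e) (auto intro: that[of 1])
  obtain n where "measure M A0 / r < 2 ^ n" using real_arch_pow[of 2] by auto
  then have n: "measure M A0 < r * 2 ^ n" using r by (simp add: pos_divide_less_eq mult.commute)
  obtain B where B: "B \<in> sets M" "B \<subseteq> A0" "0 < measure M B" "measure M B * 2 ^ n \<le> measure M A0"
    using halve by blast
  then have "measure M B * 2 ^ n < r * 2 ^ n" using n by linarith
  then have "measure M B < r" by (rule mult_right_less_imp_less) simp
  moreover have "emeasure M B < \<infinity>" using B A0 fin emeasure_mono[of B A0 M] by (auto simp: le_less_trans)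
  ultimately have "emeasure M B < ennreal r"
    by (metis emeasure_eq_ennreal_measure ennreal_lessI infinity_ennreal_def less_irrefl r(1))
  then show thesis
    using B A0 r by (intro that[of B]) (auto simp: measure_def enn2real_positive_iff)
qed

text \<open>Sierpinski's theorem, by exhaustion: each step adds a set of at least half the largest
  measure still admissible, so the increments could not tend to 0 if the target were missed.\<close>

lemma nonatomic_subset_measure:
  assumes "nonatomic M" and A: "A \<in> sets M" and t: "0 \<le> t" "ennreal t \<le> emeasure M A"
  obtains B where "B \<in> sets M" "B \<subseteq> A" "emeasure M B = ennreal t"
proof -
  define P where "P B \<longleftrightarrow> B \<in> fmeasurable M \<and> B \<subseteq> A \<and> measure M B \<le> t" for B
  define Q where "Q B B' \<longleftrightarrow> B \<subseteq> B' \<and>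
    (\<forall>C\<in>fmeasurable M. C \<subseteq> A - B \<longrightarrow> measure M B + measure M C \<le> t \<longrightarrow>
      measure M C \<le> 2 * (measure M B' - measure M B))" for B B'
  have "\<exists>f. \<forall>n::nat. P (f n) \<and> Q (f n) (f (Suc n))"
  proof (rule dependent_nat_choice)
    show "\<exists>B. P B" using t by (intro exI[of _ "{}"]) (auto simp: P_def)
  next
    fix B assume B: "P B"
    \<comment> \<open>The measures of the sets that may still be added. The supremum need not be
      attained, but half of it is exceeded when it is positive; when it is 0, the empty set
      serves.\<close>
    define S where "S = {measure M C |C. C \<in> fmeasurable M \<and> C \<subseteq> A - B \<and> measure M B + measure M C \<le> t}"
    have "0 \<in> S" using B by (auto simp: S_def P_def intro!: exI[of _ "{}"])
    have "x \<le> t" if "x \<in> S" for x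
      using that measure_nonneg[of M B] by (auto simp: S_def simp del: measure_nonneg)
    then have bdd: "bdd_above S" by (auto simp: bdd_above_def)
    have Sup0: "0 \<le> Sup S" using \<open>0 \<in> S\<close> bdd by (rule cSup_upper)
    have "\<exists>x\<in>S. Sup S \<le> 2 * x"
    proof (cases "Sup S = 0")
      case False
      then have "Sup S / 2 < Sup S" using Sup0 by simp
      then obtain x where "x \<in> S" "Sup S / 2 < x"
        using \<open>0 \<in> S\<close> less_cSup_iff[OF _ bdd] by blast
      then show ?thesis by (intro bexI[of _ x]) auto
    qed (use \<open>0 \<in> S\<close> in auto)
    then obtain C where C: "C \<in> fmeasurable M" "C \<subseteq> A - B" "measure M B + measure M C \<le> t"
      "Sup S \<le> 2 * measure M C" by (auto simp: S_def)
    have eq: "measure M (B \<union> C) = measure M B + measure M C"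
    proof -
      have "B \<inter> C = {}" using C(2) by auto
      then show ?thesis using B C(1) by (simp add: P_def measure_Un3)
    qed
    have "P (B \<union> C)" using B C eq by (auto simp: P_def)
    moreover have "Q B (B \<union> C)"
      unfolding Q_def eq
    proof (intro conjI ballI impI)
      fix D assume "D \<in> fmeasurable M" "D \<subseteq> A - B" "measure M B + measure M D \<le> t"
      then have "measure M D \<in> S" by (auto simp: S_def)
      then have "measure M D \<le> Sup S" using bdd by (rule cSup_upper)
      then show "measure M D \<le> 2 * (measure M B + measure M C - measure M B)" using C by simp
    qed auto
    ultimately show "\<exists>B'. P B' \<and> Q B B'" by blast
  qed
  then obtain f where f: "\<And>n. P (f n)" "\<And>n. Q (f n) (f (Suc n))" by blast
  have inc: "incseq f" using f(2) by (intro incseq_SucI) (auto simp: Q_def)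
  have fm: "f n \<in> fmeasurable M" for n using f(1) by (auto simp: P_def)
  then have sets: "range f \<subseteq> sets M" by auto
  define B where "B = (\<Union>n. f n)"
  have BA: "B \<subseteq> A" using f(1) by (auto simp: B_def P_def)
  have [measurable]: "B \<in> sets M" using sets by (auto simp: B_def)
  have "emeasure M B = (SUP n. emeasure M (f n))"
    unfolding B_def using SUP_emeasure_incseq[OF sets inc] by simp
  also have "\<dots> \<le> ennreal t"
    using f(1) fm by (intro SUP_least) (auto simp: P_def emeasure_eq_measure2 ennreal_leI)
  finally have Bt: "emeasure M B \<le> ennreal t" .
  then have Bf: "B \<in> fmeasurable M" by (auto simp: fmeasurable_def le_less_trans)
  have le: "measure M (f n) \<le> measure M B" for n
    using fm Bf by (intro measure_mono_fmeasurable) (auto simp: B_def)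
  have "emeasure M B = ennreal t"
  proof (rule ccontr)
    assume "emeasure M B \<noteq> ennreal t"
    then have lt: "emeasure M B < ennreal t" using Bt by simp
    then have lt': "measure M B < t"
      using emeasure_eq_measure2[OF Bf] by (simp add: ennreal_less_iff)
    have "emeasure M A = emeasure M B + emeasure M (A - B)"
      using BA A by (subst plus_emeasure) (auto simp: Un_absorb1)
    then have "0 < emeasure M (A - B)"
      using lt t(2) by (metis add.right_neutral leD zero_less_iff_neq_zero)
    \<comment> \<open>\<open>C\<close> avoids all \<open>f n\<close> and fits into the remaining
      gap, so it was admissible at every stage.\<close>
    then obtain C where C: "C \<in> sets M" "C \<subseteq> A - B" "0 < emeasure M C" "emeasure M C < ennreal (t - measure M B)"
      using nonatomic_small_subset[OF assms(1), of "A - B" "ennreal (t - measure M B)"] A lt' by auto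
    then have Cf: "C \<in> fmeasurable M" by (auto simp: fmeasurable_def intro: less_trans)
    have C': "0 < measure M C" "measure M C < t - measure M B"
      using C emeasure_eq_measure2[OF Cf] by (auto simp: ennreal_less_iff)
    have "measure M C \<le> 2 * (measure M (f (Suc n)) - measure M (f n))" for n
    proof -
      have "C \<subseteq> A - f n" using C by (auto simp: B_def)
      moreover have "measure M (f n) + measure M C \<le> t" using le[of n] C' by simp
      ultimately show ?thesis using f(2)[of n] Cf by (auto simp: Q_def)
    qed
    moreover have "(\<lambda>n. measure M (f n)) \<longlonglongrightarrow> measure M B"
      unfolding B_def using sets inc Bf by (intro Lim_measure_incseq) (auto simp: B_def fmeasurable_def)
    then have "(\<lambda>n. 2 * (measure M (f (Suc n)) - measure M (f n))) \<longlonglongrightarrow> 2 * (measure M B - measure M B)"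
      by (intro tendsto_intros LIMSEQ_Suc)
    ultimately have "measure M C \<le> 2 * (measure M B - measure M B)"
      by (intro LIMSEQ_le_const) auto
    then show False using C' by simp
  qed
  then show thesis using BA by (intro that[of B]) auto
qed

text \<open>Sierpinski's theorem inside \<open>C - A\<close>. It allows a new set to be inserted
  into a chain already built.\<close>

lemma nonatomic_between:
  assumes "nonatomic M" and A: "A \<in> sets M" "C \<in> sets M" "A \<subseteq> C"
    and v: "emeasure M A \<le> v" "v \<le> emeasure M C"
  obtains B where "B \<in> sets M" "A \<subseteq> B" "B \<subseteq> C" "emeasure M B = v"
proof (cases v)
  case top
  then show thesis using A v by (intro that[of C]) (auto simp: top_unique)
next
  case (real r)
  have fin: "emeasure M A < \<infinity>" using v real by (auto simp: le_less_trans)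
  then have mA: "emeasure M A = ennreal (measure M A)" by (simp add: emeasure_eq_ennreal_measure)
  then have mr: "measure M A \<le> r" using v real by simp
  have eq: "emeasure M C = emeasure M A + emeasure M (C - A)"
    using A by (subst plus_emeasure) (auto simp: Un_absorb1)
  have "ennreal (r - measure M A) \<le> emeasure M (C - A)"
    using v(2) mr unfolding eq mA real(2)
    by (metis ennreal_minus ennreal_minus_le_iff measure_nonneg ennreal_neq_top)
  then obtain D where D: "D \<in> sets M" "D \<subseteq> C - A" "emeasure M D = ennreal (r - measure M A)"
    using nonatomic_subset_measure[OF assms(1), of "C - A" "r - measure M A"] A mr by auto
  have "emeasure M (A \<union> D) = emeasure M A + emeasure M D"
    using A D by (subst plus_emeasure) auto
  also have "\<dots> = v" using real mr D mA by (simp add: ennreal_plus[symmetric] del: ennreal_plus)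
  finally show thesis using A D by (intro that[of "A \<union> D"]) auto
qed

text \<open>Used with \<open>y\<close> and with its negative to find the nearest level above and
  below a new one.\<close>

lemma finite_ex_minimizer:
  fixes y :: "'i \<Rightarrow> 'b::linorder"
  assumes "finite S" "S \<noteq> {}"
  obtains j where "j \<in> S" "\<And>i. i \<in> S \<Longrightarrow> y j \<le> y i"
proof -
  have "Min (y ` S) \<in> y ` S" using assms by (intro Min_in) auto
  then obtain j where "j \<in> S" "y j = Min (y ` S)" by (metis imageE)
  then show thesis using assms by (intro that[of j]) auto
qed

text \<open>Sets of measure \<open>\<eta> q\<close> are chosen, decreasing in the rational level
  \<open>q\<close>, and the function is the supremum of the levels whose sets contain the point.
  Right continuity of \<open>\<eta>\<close> recovers the real levels from the rational ones.\<close>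

lemma ex_distr_fun_eq:
  fixes M :: "'a measure" and M' :: "'b measure"
  assumes "nonatomic M" and g: "g \<in> borel_measurable M'" "fin_rearr M' g"
    and total: "emeasure M' (space M') = emeasure M (space M)"
  obtains f where "f \<in> borel_measurable M" "\<And>y. 0 \<le> y \<Longrightarrow> distr_fun M f y = distr_fun M' g y"
proof -
  define \<eta> where "\<eta> = distr_fun M' g"
  have anti: "\<eta> y \<le> \<eta> x" if "x \<le> y" for x y
    unfolding \<eta>_def by (rule distr_fun_antimono[OF g(1) that])
  define R where "R = {q \<in> \<rat>. 0 \<le> (q::real)}"
  define y where "y = from_nat_into R"
  have "countable R" unfolding R_def by (rule countable_subset[OF _ countable_rat]) auto
  moreover have "R \<noteq> {}" unfolding R_def by force
  ultimately have y: "range y = R" unfolding y_def by (intro range_from_nat_into)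
  \<comment> \<open>The levels come in the order of an enumeration, so each new set must fit among
    those already built. The two inclusions also force equal sets at equal levels.\<close>
  have "\<exists>G. \<forall>n. G n \<in> sets M \<and> emeasure M (G n) = \<eta> (y n) \<and>
    (\<forall>i<n. (y i \<le> y n \<longrightarrow> G n \<subseteq> G i) \<and> (y n \<le> y i \<longrightarrow> G i \<subseteq> G n))"
  proof (rule dependent_wellorder_choice)
    fix n :: nat and G
    assume IH: "\<And>m. m < n \<Longrightarrow> G m \<in> sets M \<and> emeasure M (G m) = \<eta> (y m) \<and>
      (\<forall>i<m. (y i \<le> y m \<longrightarrow> G m \<subseteq> G i) \<and> (y m \<le> y i \<longrightarrow> G i \<subseteq> G m))"
    have G: "G j \<subseteq> G i" if "i < n" "j < n" "y i \<le> y j" for i j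
      using IH[of i] IH[of j] that by (cases i j rule: linorder_cases) auto
    have le: "\<eta> (y n) \<le> emeasure M (space M)"
      using distr_fun_le_space[of M' g] total by (simp add: \<eta>_def)
    \<comment> \<open>By nestedness, the union of the sets at levels above \<open>y n\<close> is the
      one at the nearest such level, or empty. Dually \<open>U\<close> is the set at the nearest
      level below, or the whole space.\<close>
    obtain L where L: "L \<in> sets M" "\<And>i. i < n \<Longrightarrow> y n \<le> y i \<Longrightarrow> G i \<subseteq> L"
      "emeasure M L \<le> \<eta> (y n)" "L = {} \<or> (\<exists>j<n. y n \<le> y j \<and> L = G j)"
    proof (cases "{i. i < n \<and> y n \<le> y i} = {}")
      case True
      then show thesis by (intro that[of "{}"]) auto
    next
      case False
      then obtain j where j: "j < n" "y n \<le> y j" "\<And>i. i < n \<Longrightarrow> y n \<le> y i \<Longrightarrow> y j \<le> y i"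
        by (rule finite_ex_minimizer[where y = y, rotated]) auto
      then show thesis using IH[of j] G anti by (intro that[of "G j"]) auto
    qed
    obtain U where U: "U \<in> sets M" "\<And>i. i < n \<Longrightarrow> y i \<le> y n \<Longrightarrow> U \<subseteq> G i"
      "\<eta> (y n) \<le> emeasure M U" "U = space M \<or> (\<exists>j<n. y j \<le> y n \<and> U = G j)"
    proof (cases "{i. i < n \<and> y i \<le> y n} = {}")
      case True
      then show thesis using le by (intro that[of "space M"]) auto
    next
      case False
      then obtain j where j: "j < n" "y j \<le> y n" "\<And>i. i < n \<Longrightarrow> y i \<le> y n \<Longrightarrow> y i \<le> y j"
        by (rule finite_ex_minimizer[where y = "\<lambda>i. - y i", rotated]) auto
      then show thesis using IH[of j] G anti by (intro that[of "G j"]) auto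
    qed
    have "L \<subseteq> U" using L U G sets.sets_into_space[OF L(1)] by (metis empty_subsetI order_trans)
    then obtain B where "B \<in> sets M" "L \<subseteq> B" "B \<subseteq> U" "emeasure M B = \<eta> (y n)"
      using nonatomic_between[OF assms(1) L(1) U(1) _ L(3) U(3)] by blast
    then show "\<exists>B. B \<in> sets M \<and> emeasure M B = \<eta> (y n) \<and>
      (\<forall>i<n. (y i \<le> y n \<longrightarrow> B \<subseteq> G i) \<and> (y n \<le> y i \<longrightarrow> G i \<subseteq> B))"
      using L(2) U(2) by (intro exI[of _ B]) blast
  qed simp
  then obtain G where "\<And>n. G n \<in> sets M \<and> emeasure M (G n) = \<eta> (y n) \<and>
    (\<forall>i<n. (y i \<le> y n \<longrightarrow> G n \<subseteq> G i) \<and> (y n \<le> y i \<longrightarrow> G i \<subseteq> G n))" by blast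
  then have Gs [measurable]: "\<And>n. G n \<in> sets M" and Gm: "\<And>n. emeasure M (G n) = \<eta> (y n)"
    and G: "\<And>i j. y i \<le> y j \<Longrightarrow> G j \<subseteq> G i"
    by (blast, blast, metis linorder_neqE_nat order_refl)
  \<comment> \<open>Taken in \<open>ennreal\<close>, as the supremum may be infinite on a null
    set.\<close>
  define F where "F \<omega> = (SUP n. ennreal (y n) * indicator (G n) \<omega>)" for \<omega>
  have [measurable]: "F \<in> borel_measurable M" unfolding F_def by measurable
  have F: "emeasure M {\<omega> \<in> space M. ennreal z < F \<omega>} = \<eta> z" if z: "0 \<le> z" for z
  proof -
    define D where "D n = (if z < y n then G n else {})" for n
    have [measurable]: "D n \<in> sets M" for n by (simp add: D_def)
    have "ennreal z < ennreal (y n) * indicator (G n) \<omega> \<longleftrightarrow> \<omega> \<in> D n" for n \<omega>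
      using z by (auto simp: D_def indicator_def ennreal_less_iff)
    then have eq: "{\<omega> \<in> space M. ennreal z < F \<omega>} = (\<Union>n. D n)"
      using sets.sets_into_space[OF Gs] by (auto simp: F_def less_SUP_iff D_def)
    show ?thesis
    proof (rule antisym)
      \<comment> \<open>A finite union of nested sets lies in the one of lowest level, which is
        still above \<open>z\<close>; the countable union is exhausted by finite ones.\<close>
      have "emeasure M (\<Union>n. D n) = emeasure M (\<Union>k. \<Union>n<k. D n)"
        by (rule arg_cong[of _ _ "emeasure M"]) auto
      also have "\<dots> = (SUP k. emeasure M (\<Union>n<k. D n))"
        by (intro SUP_emeasure_incseq[symmetric] incseq_SucI) (auto simp: lessThan_Suc)
      also have "\<dots> \<le> \<eta> z"
      proof (rule SUP_least)
        fix k
        show "emeasure M (\<Union>n<k. D n) \<le> \<eta> z"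
        proof (cases "{n. n < k \<and> z < y n} = {}")
          case True
          then have "(\<Union>n<k. D n) = {}" by (auto simp: D_def)
          then show ?thesis by simp
        next
          case False
          then obtain j where j: "j < k" "z < y j" "\<And>n. n < k \<Longrightarrow> z < y n \<Longrightarrow> y j \<le> y n"
            by (rule finite_ex_minimizer[where y = y, rotated]) auto
          have "(\<Union>n<k. D n) \<subseteq> G j"
            using j G by (auto simp: D_def split: if_splits)
          then have "emeasure M (\<Union>n<k. D n) \<le> \<eta> (y j)"
            using Gm[of j] Gs by (metis emeasure_mono)
          then show ?thesis using anti[of z "y j"] j by simp
        qed
      qed
      finally show "emeasure M {\<omega> \<in> space M. ennreal z < F \<omega>} \<le> \<eta> z" unfolding eq .
    next
      show "\<eta> z \<le> emeasure M {\<omega> \<in> space M. ennreal z < F \<omega>}"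
      proof (rule dense_le)
        fix v assume "v < \<eta> z"
        then obtain z' where z': "z < z'" "v < \<eta> z'"
          using distr_fun_right_continuous[OF g(1)] by (auto simp: \<eta>_def)
        obtain q where q: "q \<in> \<rat>" "z < q" "q < z'" using Rats_dense_in_real[OF z'(1)] by blast
        then have "q \<in> range y" using z y by (auto simp: R_def)
        then obtain n where n: "q = y n" by blast
        have "v \<le> \<eta> z'" using z' by simp
        also have "\<dots> \<le> \<eta> q" using q by (intro anti) simp
        also have "\<dots> = emeasure M (D n)" using Gm q n by (simp add: D_def)
        also have "\<dots> \<le> emeasure M (\<Union>n. D n)" by (intro emeasure_mono) auto
        finally show "v \<le> emeasure M {\<omega> \<in> space M. ennreal z < F \<omega>}" unfolding eq .
      qed
    qed
  qed
  \<comment> \<open>Finiteness almost everywhere rests on \<open>\<eta>\<close> tending to 0, that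
    is, on \<open>fin_rearr M' g\<close>.\<close>
  have "emeasure M {\<omega> \<in> space M. F \<omega> = \<infinity>} \<le> 0"
  proof (rule LIMSEQ_le_const)
    show "(\<lambda>n. \<eta> (real n)) \<longlonglongrightarrow> 0" unfolding \<eta>_def by (rule distr_fun_tendsto_0[OF g])
    have "emeasure M {\<omega> \<in> space M. F \<omega> = \<infinity>} \<le> \<eta> (real n)" for n
      unfolding F[of "real n", OF of_nat_0_le_iff, symmetric] by (intro emeasure_mono) auto
    then show "\<exists>N. \<forall>n\<ge>N. emeasure M {\<omega> \<in> space M. F \<omega> = \<infinity>} \<le> \<eta> (real n)" by blast
  qed
  then have ae: "AE \<omega> in M. F \<omega> \<noteq> \<infinity>"
    by (subst AE_iff_measurable[OF _ refl]) auto
  have "distr_fun M (\<lambda>\<omega>. enn2real (F \<omega>)) z = \<eta> z" if "0 \<le> z" for z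
    unfolding distr_fun_def F[OF that, symmetric]
  proof (rule emeasure_eq_AE)
    show "AE \<omega> in M. \<omega> \<in> {\<omega> \<in> space M. z < \<bar>enn2real (F \<omega>)\<bar>} \<longleftrightarrow> \<omega> \<in> {\<omega> \<in> space M. ennreal z < F \<omega>}"
      using ae
    proof eventually_elim
      case (elim \<omega>)
      then show ?case using that by (cases "F \<omega>") (auto simp: ennreal_less_iff)
    qed
  qed auto
  then show thesis by (intro that[of "\<lambda>\<omega>. enn2real (F \<omega>)"]) (auto simp: \<eta>_def)
qed

section \<open>Symmetric spaces\<close>

text \<open>The Banach alternative is \<open>K = 1\<close>, so one constant covers both. Spaces
  shown to satisfy the locale are symmetric through the quasi-Banach alternative.\<close>

locale symm_space =
  fixes S :: "'b measure" and E :: "('b \<Rightarrow> real) set set" and N :: "('b \<Rightarrow> real) set \<Rightarrow> real"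
    and K :: real
  assumes K: "1 \<le> K" and subspace: "L0_subspace S E" and quasi_norm: "quasi_norm_on S E N K"
    and complete: "complete_on S E N" and nontrivial: "E \<noteq> {ae_class S (\<lambda>x. 0)}"
    and ideal: "\<And>f g. f \<in> borel_measurable S \<Longrightarrow> ae_class S g \<in> E \<Longrightarrow>
      (AE x in S. \<bar>f x\<bar> \<le> \<bar>g x\<bar>) \<Longrightarrow> ae_class S f \<in> E \<and> N (ae_class S f) \<le> N (ae_class S g)"
    and equidistr: "\<And>f g. f \<in> borel_measurable S \<Longrightarrow> ae_class S g \<in> E \<Longrightarrow>
      (\<And>x. 0 \<le> x \<Longrightarrow> distr_fun S f x = distr_fun S g x) \<Longrightarrow>
      ae_class S f \<in> E \<and> N (ae_class S f) = N (ae_class S g)"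

lemma symmetric_space_iff: "symmetric_space S E N \<longleftrightarrow> (\<exists>K. symm_space S E N K)"
proof
  assume sym: "symmetric_space S E N"
  then have "banach_on S E N \<or> quasi_banach_on S E N" by (simp add: symmetric_space_def)
  then obtain K where "1 \<le> K" "L0_subspace S E" "quasi_norm_on S E N K" "complete_on S E N"
    by (auto simp: banach_on_def quasi_banach_on_def)
  then have "symm_space S E N K"
    using sym unfolding symm_space_def symmetric_space_def by blast
  then show "\<exists>K. symm_space S E N K" by blast
next
  assume "\<exists>K. symm_space S E N K"
  then show "symmetric_space S E N"
    unfolding symmetric_space_def quasi_banach_on_def symm_space_def by blast
qed

context symm_space
begin

abbreviation mem :: "('b \<Rightarrow> real) \<Rightarrow> bool" where "mem f \<equiv> ae_class S f \<in> E"
abbreviation nrm :: "('b \<Rightarrow> real) \<Rightarrow> real" where "nrm f \<equiv> N (ae_class S f)"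

lemma mem_measurable: "mem f \<Longrightarrow> f \<in> borel_measurable S"
  using subspace ae_class_in_L0_iff[of S f] by (auto simp: L0_subspace_def)

lemma mem_0: "mem (\<lambda>x. 0)" using subspace by (simp add: L0_subspace_def)

lemma nrm_nonneg: "mem f \<Longrightarrow> 0 \<le> nrm f" using quasi_norm by (simp add: quasi_norm_on_def)

lemma nrm_0: "nrm (\<lambda>x. 0) = 0" using quasi_norm mem_0 by (simp add: quasi_norm_on_def)

lemma nrm_eq_0: "mem f \<Longrightarrow> nrm f = 0 \<Longrightarrow> AE x in S. f x = 0"
  using quasi_norm mem_measurable ae_class_eq_iff[of f S "\<lambda>x. 0"] by (simp add: quasi_norm_on_def)

lemma mem_add: "mem f \<Longrightarrow> mem g \<Longrightarrow> mem (\<lambda>x. f x + g x)"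
  using subspace by (simp add: L0_subspace_def)

lemma nrm_add: "mem f \<Longrightarrow> mem g \<Longrightarrow> nrm (\<lambda>x. f x + g x) \<le> K * (nrm f + nrm g)"
  using quasi_norm by (simp add: quasi_norm_on_def)

lemma mem_cmult: "mem f \<Longrightarrow> mem (\<lambda>x. c * f x)"
  using subspace by (simp add: L0_subspace_def)

lemma nrm_cmult: "mem f \<Longrightarrow> nrm (\<lambda>x. c * f x) = \<bar>c\<bar> * nrm f"
  using quasi_norm by (simp add: quasi_norm_on_def)

lemma mem_diff: "mem f \<Longrightarrow> mem g \<Longrightarrow> mem (\<lambda>x. f x - g x)"
  using mem_add[OF _ mem_cmult[of g "-1"], of f] by simp

lemma nrm_minus_commute: "mem f \<Longrightarrow> mem g \<Longrightarrow> nrm (\<lambda>x. f x - g x) = nrm (\<lambda>x. g x - f x)"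
  using nrm_cmult[of "\<lambda>x. f x - g x" "-1"] mem_diff[of f g] by simp

text \<open>If every superlevel set of \<open>h\<close> had infinite measure, then the indicators of these sets would
  all be equidistributed with the constant 1, whose norm would then be at most
  \<open>nrm h / n\<close> for every \<open>n\<close>.\<close>

lemma mem_fin_rearr:
  assumes h: "mem h"
  shows "fin_rearr S h"
proof (rule ccontr)
  note [measurable] = mem_measurable[OF h]
  assume "\<not> fin_rearr S h"
  then have inf: "distr_fun S h y = \<infinity>" if "0 \<le> y" for y
    using that by (auto simp: fin_rearr_def less_top[symmetric])
  then have total: "emeasure S (space S) = \<infinity>"
    using distr_fun_le_space[of S h 0] by (simp add: top_unique)
  have one: "mem (\<lambda>x. 1) \<and> nrm (\<lambda>x. 1) \<le> nrm h / real (Suc n)" for n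
  proof -
    define A where "A = {x \<in> space S. real (Suc n) < \<bar>h x\<bar>}"
    have [measurable]: "A \<in> sets S" by (simp add: A_def)
    have A: "emeasure S A = \<infinity>" using inf[of "real (Suc n)"] by (simp add: A_def distr_fun_def)
    have 1: "mem (indicator A) \<and> nrm (indicator A) \<le> nrm (\<lambda>x. (1 / real (Suc n)) * h x)"
      by (rule ideal[OF _ mem_cmult[OF h]])
         (auto simp: A_def indicator_def abs_mult field_simps)
    have "distr_fun S (\<lambda>x. 1) x = distr_fun S (indicator A) x" if "0 \<le> x" for x
    proof (cases "x < 1")
      case True
      have "{\<omega> \<in> space S. x < \<bar>indicator A \<omega> :: real\<bar>} = A"
        using True that sets.sets_into_space[of A S] by (auto simp: indicator_def split: if_splits)
      then show ?thesis using True A total by (simp add: distr_fun_def)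
    next
      case False
      then have "{\<omega> \<in> space S. x < \<bar>indicator A \<omega> :: real\<bar>} = {}"
        by (auto simp: indicator_def)
      then show ?thesis using False by (simp only: distr_fun_def) simp
    qed
    then have "mem (\<lambda>x. 1) \<and> nrm (\<lambda>x. 1) = nrm (indicator A)"
      using 1 by (intro equidistr) auto
    then show ?thesis using 1 nrm_cmult[OF h, of "1 / real (Suc n)"] by simp
  qed
  have "(\<lambda>n. nrm h / real (Suc n)) \<longlonglongrightarrow> 0" by (rule LIMSEQ_Suc[OF lim_const_over_n])
  then have "nrm (\<lambda>x. 1) \<le> 0" using one by (intro LIMSEQ_le_const) auto
  then have "AE x in S. (1::real) = 0" using one nrm_nonneg by (intro nrm_eq_0) (auto intro: antisym)
  then have "emeasure S (space S) = 0" by (subst (asm) AE_iff_measurable[OF _ refl]) auto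
  then show False using total by simp
qed

lemma mem_sum:
  fixes m n :: nat
  assumes "\<And>k. mem (g k)"
  shows "mem (\<lambda>x. \<Sum>k\<in>{m..<m+n}. g k x)"
proof (induction n)
  case (Suc n)
  then show ?case using mem_add[OF Suc assms[of "m + n"]] by simp
qed (simp add: mem_0)

text \<open>Splitting off one term costs a factor \<open>K\<close> and doubles the bound; the ratio
  \<open>2 * K\<close> of the geometric decay absorbs both.\<close>

lemma nrm_sum_le:
  assumes "\<And>k. mem (g k)" and g: "\<And>k. nrm (g k) \<le> d / (2 * K) ^ Suc k"
  shows "nrm (\<lambda>x. \<Sum>k\<in>{m..<m+n}. g k x) \<le> d / (2 * K) ^ m"
proof (induction n arbitrary: m)
  case 0
  \<comment> \<open>The empty sum needs \<open>0 \<le> d\<close>, which follows from the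
    nonnegativity of a norm.\<close>
  have "0 \<le> d / (2 * K) ^ Suc m" using nrm_nonneg[OF assms(1)[of m]] g[of m] by linarith
  moreover have "0 < (2 * K) ^ Suc m" using K by (intro zero_less_power) simp
  ultimately have "0 \<le> d" by (simp add: zero_le_divide_iff del: power_Suc)
  then show ?case using K by (simp add: nrm_0)
next
  case (Suc n)
  have "{m..<m + Suc n} = insert m {Suc m..<Suc m + n}" by auto
  then have "(\<lambda>x. \<Sum>k\<in>{m..<m + Suc n}. g k x) = (\<lambda>x. g m x + (\<Sum>k\<in>{Suc m..<Suc m + n}. g k x))"
    by simp
  then have "nrm (\<lambda>x. \<Sum>k\<in>{m..<m + Suc n}. g k x)
      \<le> K * (nrm (g m) + nrm (\<lambda>x. \<Sum>k\<in>{Suc m..<Suc m + n}. g k x))"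
    using nrm_add[OF assms(1)[of m] mem_sum[of g "Suc m" n, OF assms(1)]] by simp
  also have "\<dots> \<le> K * (d / (2 * K) ^ Suc m + d / (2 * K) ^ Suc m)"
    using K g[of m] Suc.IH[of "Suc m"] by (intro mult_left_mono add_mono) auto
  also have "\<dots> = d / (2 * K) ^ m" using K by (simp add: field_simps)
  finally show ?case .
qed

text \<open>The norm limit dominates the partial sums without any link to convergence almost everywhere:
  \<open>max 0 (sum up to m - limit)\<close> is dominated by \<open>|sum up to n - limit|\<close> for all \<open>n \<ge> m\<close>, so it has
  norm 0.\<close>

lemma riesz_fischer:
  assumes gm: "\<And>k. mem (g k)" and g: "\<And>k. nrm (g k) \<le> d / (2 * K) ^ Suc k"
    and pos: "\<And>k x. 0 \<le> g k x"
  obtains h where "mem h" "nrm h \<le> K * d" "AE x in S. \<forall>n. (\<Sum>k<n. g k x) \<le> h x"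
proof -
  define s where "s n x = (\<Sum>k<n. g k x)" for n x
  have s: "mem (s n)" for n
    using mem_sum[of g 0 n, OF gm] by (simp add: s_def[abs_def] lessThan_atLeast0)
  have diff: "s n x - s m x = (\<Sum>k\<in>{m..<m + (n - m)}. g k x)" if "m \<le> n" for m n x
    using that by (simp add: s_def lessThan_atLeast0 sum_diff_nat_ivl)
  have le: "nrm (\<lambda>x. s n x - s m x) \<le> d / (2 * K) ^ m" if "m \<le> n" for m n
    using nrm_sum_le[of g d m "n - m", OF gm g] diff[OF that] by simp
  have d: "0 \<le> d"
    using order_trans[OF nrm_nonneg[OF mem_diff[OF s[of 0] s[of 0]]] le[of 0 0]] by simp
  have lim: "(\<lambda>m. d / (2 * K) ^ m) \<longlonglongrightarrow> 0"
    using K LIMSEQ_divide_realpow_zero[of "2 * K" d] by simp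
  have "\<exists>k. \<forall>m\<ge>k. \<forall>n\<ge>k. nrm (\<lambda>x. s m x - s n x) < e" if "0 < e" for e
  proof -
    obtain k where k: "\<And>m. m \<ge> k \<Longrightarrow> d / (2 * K) ^ m < e"
      using order_tendstoD(2)[OF lim \<open>0 < e\<close>] by (auto simp: eventually_sequentially)
    have "nrm (\<lambda>x. s m x - s n x) < e" if "m \<ge> k" "n \<ge> k" for m n
    proof (cases "n \<le> m")
      case True
      then show ?thesis using le[OF True] k[OF that(2)] by linarith
    next
      case False
      then show ?thesis using le[of m n] k[OF that(1)] nrm_minus_commute[OF s s, of m n] by simp
    qed
    then show ?thesis by blast
  qed
  then obtain h where h: "mem h" "(\<lambda>n. nrm (\<lambda>x. s n x - h x)) \<longlonglongrightarrow> 0"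
    using complete s unfolding complete_on_def by blast
  note [measurable] = mem_measurable[OF h(1)] mem_measurable[OF s]
  have "AE x in S. s m x \<le> h x" for m
  proof -
    let ?p = "\<lambda>x. max 0 (s m x - h x)"
    have dom: "mem ?p \<and> nrm ?p \<le> nrm (\<lambda>x. s n x - h x)" if "m \<le> n" for n
    proof (rule ideal[OF _ mem_diff[OF s h(1)]])
      have "s m x \<le> s n x" for x
        unfolding s_def using that pos by (intro sum_mono2) auto
      then show "AE x in S. \<bar>?p x\<bar> \<le> \<bar>s n x - h x\<bar>"
        by (intro AE_I2) (smt (verit))
    qed measurable
    then have "nrm ?p \<le> 0" using h(2) by (intro LIMSEQ_le_const) auto
    then have "AE x in S. ?p x = 0"
      using dom[OF order_refl] nrm_nonneg by (intro nrm_eq_0) (auto intro: antisym)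
    then show ?thesis by eventually_elim (simp add: max_def split: if_splits)
  qed
  then have ae: "AE x in S. \<forall>n. s n x \<le> h x" by (simp add: AE_all_countable)
  \<comment> \<open>A quasi-norm need not be continuous, so the bound passes to the limit through
    \<open>h = s n + (h - s n)\<close>, at the price of \<open>K\<close>.\<close>
  have "nrm h \<le> K * (d + nrm (\<lambda>x. s n x - h x))" for n
  proof -
    have "nrm (\<lambda>x. s n x + (h x - s n x)) \<le> K * (nrm (s n) + nrm (\<lambda>x. h x - s n x))"
      by (intro nrm_add s mem_diff h(1))
    moreover have "nrm (s n) \<le> d" using le[of 0 n] by (simp add: s_def[abs_def])
    ultimately show ?thesis
      using K nrm_minus_commute[OF s h(1), of n] by (simp add: mult_left_mono order_trans)
  qed
  moreover have "(\<lambda>n. K * (d + nrm (\<lambda>x. s n x - h x))) \<longlonglongrightarrow> K * (d + 0)"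
    by (intro tendsto_intros h(2))
  ultimately have "nrm h \<le> K * (d + 0)" by (intro LIMSEQ_le_const) auto
  then show thesis using h(1) ae by (intro that[of h]) (auto simp: s_def)
qed

end

section \<open>Dyadic shells of one parity\<close>

text \<open>If k is the integer part of log 2 s, the shells k - 1 and k - 2 lie below s and have
  opposite parity. The one excluded by \<open>P\<close> has measure at least 2^(k-2), which exceeds
  s/8 since s < 2^(k+1).\<close>

lemma dyadic_shell_measure:
  assumes P: "P = even \<or> P = odd" and "0 < s"
  shows "emeasure lebesgue {t \<in> {0..<s}. P \<lfloor>log 2 t\<rfloor>} \<le> ennreal (7 / 8 * s)"
proof -
  define k where "k = \<lfloor>log 2 s\<rfloor>"
  have "real_of_int k \<le> log 2 s" "log 2 s < real_of_int k + 1" by (simp_all add: k_def)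
  then have s: "2 powr k \<le> s" "s < 2 powr (real_of_int k + 1)"
    using \<open>0 < s\<close> by (simp_all add: le_log_iff log_less_iff)
  have alternate: "P (i - 1) \<longleftrightarrow> \<not> P i" for i using P by auto
  obtain j where j: "j = k - 1 \<or> j = k - 2" "\<not> P j"
    using alternate[of k] alternate[of "k - 1"] by (cases "P k") auto
  let ?J = "{2 powr real_of_int j..<2 powr (real_of_int j + 1)} :: real set"
  have js: "2 powr (real_of_int j + 1) \<le> s"
    using j by (intro order_trans[OF powr_mono s(1)]) auto
  have J: "?J \<subseteq> {0..<s}"
  proof
    fix t assume "t \<in> ?J"
    then have "2 powr real_of_int j \<le> t" "t < 2 powr (real_of_int j + 1)" by simp_all
    with js show "t \<in> {0..<s}"
      using order_trans[OF powr_ge_zero \<open>2 powr real_of_int j \<le> t\<close>] by simp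
  qed
  have "\<lfloor>log 2 t\<rfloor> = j" if "t \<in> ?J" for t
  proof -
    have "0 < t" using that less_le_trans[OF powr_gt_zero[of 2 "real_of_int j", THEN iffD2]] by simp
    then show ?thesis using that by (intro floor_unique) (auto simp: le_log_iff log_less_iff)
  qed
  then have sub: "{t \<in> {0..<s}. P \<lfloor>log 2 t\<rfloor>} \<subseteq> {0..<s} - ?J" using j by auto
  have J': "2 powr (real_of_int j + 1) = 2 * 2 powr j" by (simp add: powr_add)
  have "emeasure lebesgue {t \<in> {0..<s}. P \<lfloor>log 2 t\<rfloor>} \<le> emeasure lebesgue ({0..<s} - ?J)"
    using sub by (intro emeasure_mono) auto
  also have "\<dots> = ennreal s - ennreal (2 powr j)"
    using J \<open>0 < s\<close> by (subst emeasure_Diff) (auto simp: J')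
  also have "\<dots> = ennreal (s - 2 powr j)" by (simp add: ennreal_minus)
  also have "\<dots> \<le> ennreal (7 / 8 * s)"
  proof (rule ennreal_leI)
    have "2 powr (real_of_int k + 1) = 8 * 2 powr (real_of_int k - 2)"
      by (simp add: powr_add powr_diff)
    moreover have "2 powr (real_of_int k - 2) \<le> 2 powr j" using j by (intro powr_mono) auto
    ultimately show "s - 2 powr j \<le> 7 / 8 * s" using s(2) by linarith
  qed
  finally show ?thesis .
qed

text \<open>The minimum gives the bound the shape of \<open>distr_fun_rearr_dilation\<close>, with
  which it will be compared; \<open>w\<close> may exceed the total measure or be infinite.\<close>

lemma dyadic_shell_std_measure:
  assumes P: "P = even \<or> P = odd"
  shows "emeasure (std_space M) {t \<in> std_interval M. P \<lfloor>log 2 t\<rfloor> \<and> ennreal t < w}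
    \<le> min (ennreal (7 / 8) * w) (emeasure M (space M))"
proof (rule min.boundedI)
  show "emeasure (std_space M) {t \<in> std_interval M. P \<lfloor>log 2 t\<rfloor> \<and> ennreal t < w} \<le> emeasure M (space M)"
    by (rule order_trans[OF emeasure_space]) (simp add: emeasure_std_space_space)
  show "emeasure (std_space M) {t \<in> std_interval M. P \<lfloor>log 2 t\<rfloor> \<and> ennreal t < w} \<le> ennreal (7 / 8) * w"
  proof (cases w)
    case (real s)
    show ?thesis
    proof (cases "s = 0")
      case False
      then have "0 < s" using real by simp
      have "{t \<in> {0..<s}. P \<lfloor>log 2 t\<rfloor>} = {t \<in> space borel. 0 \<le> t \<and> t < s \<and> P \<lfloor>log 2 t\<rfloor>}" by auto
      also have "\<dots> \<in> sets borel" by measurable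
      finally have meas: "{t \<in> {0..<s}. P \<lfloor>log 2 t\<rfloor>} \<in> sets lebesgue"
        by (intro sets_completionI_sets) simp
      have "{t \<in> std_interval M. P \<lfloor>log 2 t\<rfloor> \<and> ennreal t < w} \<subseteq> {t \<in> {0..<s}. P \<lfloor>log 2 t\<rfloor>}"
        using real by (auto simp: ennreal_less_iff std_interval_def split: if_splits)
      then have "emeasure lebesgue {t \<in> std_interval M. P \<lfloor>log 2 t\<rfloor> \<and> ennreal t < w} \<le> ennreal (7 / 8 * s)"
        using dyadic_shell_measure[OF P \<open>0 < s\<close>] meas by (meson emeasure_mono order_trans)
      also have "\<dots> = ennreal (7 / 8) * w" using real by (simp only: real(2)) (rule ennreal_mult, auto)
      finally show ?thesis by (subst emeasure_std_space) auto
    qed (use real in simp)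
  next
    case top
    then show ?thesis by (simp add: ennreal_mult_top)
  qed
qed

section \<open>Transfer from the standard space\<close>

text \<open>Puts the rearrangements of both spaces into the same \<open>L0\<close>, so that their
  \<open>Xi\<close> can be compared.\<close>

lemma std_space_idem: "std_space (std_space M) = std_space M"
proof -
  have "std_interval (std_space M) = std_interval M"
    unfolding std_interval_def[of "std_space M"] measure_def emeasure_std_space_space
    by (simp add: std_interval_def measure_def)
  then show ?thesis by (simp add: std_space_def)
qed

locale std_symm_space = symm_space "std_space M" E N K
  for M :: "'a measure" and E N K
begin

lemma rearr_measurable: "f \<in> borel_measurable M' \<Longrightarrow> (\<lambda>t. rearr M' f (c * t)) \<in> borel_measurable (std_space M)"
  by (intro borel_measurable_std_space measurable_compose[OF _ borel_measurable_rearr]) simp_all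

text \<open>Comparing distribution functions compares the rearrangements pointwise, where the ideal
  property applies; the rearrangement of \<open>h\<close> is equidistributed with \<open>h\<close>
  and has the same norm.\<close>

lemma mem_rearr_dominated:
  assumes f: "f \<in> borel_measurable M'" and total: "emeasure M' (space M') = emeasure M (space M)"
    and h: "mem h" and le: "\<And>y. 0 \<le> y \<Longrightarrow> distr_fun M' f y \<le> distr_fun (std_space M) h y"
  shows "fin_rearr M' f" "mem (rearr M' f)" "nrm (rearr M' f) \<le> nrm h"
proof -
  note hm = mem_measurable[OF h]
  have finh: "fin_rearr (std_space M) h" by (rule mem_fin_rearr[OF h])
  then show finf: "fin_rearr M' f" using le by (force simp: fin_rearr_def intro: le_less_trans)
  have eq: "mem (rearr (std_space M) h) \<and> nrm (rearr (std_space M) h) = nrm h"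
    using rearr_measurable[OF hm, of 1]
    by (intro equidistr h) (simp_all add: distr_fun_rearr[OF hm finh] emeasure_std_space_space)
  have "mem (rearr M' f) \<and> nrm (rearr M' f) \<le> nrm (rearr (std_space M) h)"
  proof (rule ideal)
    show "AE t in std_space M. \<bar>rearr M' f t\<bar> \<le> \<bar>rearr (std_space M) h t\<bar>"
      using AE_std_space_pos
    proof eventually_elim
      case (elim t)
      have "rearr M' f t \<le> rearr (std_space M) h t"
        unfolding rearr_le_iff[OF f finf elim rearr_nonneg]
        using le[OF rearr_nonneg] rearr_le_iff[OF hm finh elim rearr_nonneg] by (metis order_refl order_trans)
      then show ?case by (simp add: rearr_nonneg)
    qed
  qed (use rearr_measurable[OF f, of 1] eq in simp_all)
  then show "mem (rearr M' f)" "nrm (rearr M' f) \<le> nrm h" using eq by auto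
qed

lemma mem_dominated:
  assumes f: "f \<in> borel_measurable (std_space M)" and h: "mem h"
    and le: "\<And>y. 0 \<le> y \<Longrightarrow> distr_fun (std_space M) f y \<le> distr_fun (std_space M) h y"
  shows "mem f \<and> nrm f \<le> nrm h"
proof -
  note dom = mem_rearr_dominated[OF f emeasure_std_space_space h le]
  have "mem f \<and> nrm f = nrm (rearr (std_space M) f)"
    using dom(2) by (intro equidistr f)
      (simp_all add: distr_fun_rearr[OF f dom(1)] emeasure_std_space_space)
  then show ?thesis using dom(3) by simp
qed

text \<open>Dilation by \<open>8/7\<close> is bounded: cutting the dilated function along alternate dyadic shells
  gives two summands, each of which keeps at most \<open>7/8\<close> of every superlevel set.\<close>

lemma mem_dilate:
  assumes f: "f \<in> borel_measurable M'" "fin_rearr M' f" and c: "0 < c"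
    and mem: "mem (\<lambda>t. rearr M' f (c * t))"
  shows "mem (\<lambda>t. rearr M' f (7 / 8 * c * t))"
    "nrm (\<lambda>t. rearr M' f (7 / 8 * c * t)) \<le> 2 * K * nrm (\<lambda>t. rearr M' f (c * t))"
proof -
  let ?r = "\<lambda>t. rearr M' f (7 / 8 * c * t)"
  define p where "p P t = (if P \<lfloor>log 2 t\<rfloor> then ?r t else 0)" for P :: "int \<Rightarrow> bool" and t
  have p: "mem (p P) \<and> nrm (p P) \<le> nrm (\<lambda>t. rearr M' f (c * t))" if P: "P = even \<or> P = odd" for P
  proof (rule mem_dominated[OF _ mem])
    have "p P \<in> borel_measurable borel"
      unfolding p_def[abs_def] using P
      by (intro measurable_If measurable_compose[OF _ borel_measurable_rearr[OF f(1)]]) auto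
    then show "p P \<in> borel_measurable (std_space M)" by (rule borel_measurable_std_space)
    then have sets: "{t \<in> space (std_space M). y < \<bar>p P t\<bar>} \<in> sets (std_space M)" for y by measurable
    fix y :: real assume y: "0 \<le> y"
    \<comment> \<open>The length of the superlevel set of \<open>?r\<close> before the cut. The
      undilated function has length 7/8 of \<open>w\<close>, just what a parity class may
      keep.\<close>
    define w where "w = ennreal (1 / (7 / 8 * c)) * distr_fun M' f y"
    have c': "0 < 7 / 8 * c" using c by simp
    have "AE t in std_space M. t \<in> {t \<in> space (std_space M). y < \<bar>p P t\<bar>}
      \<longrightarrow> t \<in> {t \<in> std_interval M. P \<lfloor>log 2 t\<rfloor> \<and> ennreal t < w}"
      using AE_std_space_pos
    proof eventually_elim
      case (elim t)
      have "ennreal t < w" if "y < ?r t"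
        using that less_dilation_iff[OF c' elim] rearr_le_iff[OF f mult_pos_pos[OF c' elim] y]
        by (simp add: w_def not_le[symmetric])
      then show ?case using y by (auto simp: p_def rearr_nonneg space_std_space split: if_splits)
    qed
    moreover have "{t \<in> std_interval M. P \<lfloor>log 2 t\<rfloor> \<and> ennreal t < w} \<in> sets (std_space M)"
    proof -
      have "{t. P \<lfloor>log 2 t\<rfloor> \<and> ennreal t < w} \<in> sets borel" using P by (auto)
      from borel_std_space_sets[OF this] show ?thesis by simp
    qed
    ultimately have "distr_fun (std_space M) (p P) y
        \<le> emeasure (std_space M) {t \<in> std_interval M. P \<lfloor>log 2 t\<rfloor> \<and> ennreal t < w}"
      unfolding distr_fun_def by (rule emeasure_mono_AE)
    also have "\<dots> \<le> min (ennreal (7 / 8) * w) (emeasure M (space M))"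
      by (rule dyadic_shell_std_measure[OF P])
    also have "ennreal (7 / 8) * w = ennreal (1 / c) * distr_fun M' f y"
      unfolding w_def mult.assoc[symmetric] using c by (simp add: ennreal_mult[symmetric] del: ennreal_mult)
    also have "min \<dots> (emeasure M (space M)) = distr_fun (std_space M) (\<lambda>t. rearr M' f (c * t)) y"
      by (rule distr_fun_rearr_dilation[OF f y c, symmetric])
    finally show "distr_fun (std_space M) (p P) y \<le> distr_fun (std_space M) (\<lambda>t. rearr M' f (c * t)) y" .
  qed
  have sum: "?r = (\<lambda>t. p even t + p odd t)" by (auto simp: p_def)
  show "mem ?r" unfolding sum using p by (intro mem_add) auto
  have "nrm ?r \<le> K * (nrm (p even) + nrm (p odd))" unfolding sum using p by (intro nrm_add) auto
  also have "\<dots> \<le> K * (nrm (\<lambda>t. rearr M' f (c * t)) + nrm (\<lambda>t. rearr M' f (c * t)))"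
    using p K by (intro mult_left_mono add_mono) auto
  finally show "nrm ?r \<le> 2 * K * nrm (\<lambda>t. rearr M' f (c * t))" by simp
qed

lemma mem_dilate_power:
  assumes f: "f \<in> borel_measurable M'" "fin_rearr M' f" "mem (rearr M' f)"
  shows "mem (\<lambda>t. rearr M' f ((7 / 8) ^ n * t)) \<and>
    nrm (\<lambda>t. rearr M' f ((7 / 8) ^ n * t)) \<le> (2 * K) ^ n * nrm (rearr M' f)"
proof (induction n)
  case (Suc n)
  then have IH: "mem (\<lambda>t. rearr M' f ((7 / 8) ^ n * t))" by simp
  have "nrm (\<lambda>t. rearr M' f (7 / 8 * (7 / 8) ^ n * t)) \<le> 2 * K * nrm (\<lambda>t. rearr M' f ((7 / 8) ^ n * t))"
    by (rule mem_dilate(2)[OF f(1,2) _ IH]) simp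
  also have "\<dots> \<le> 2 * K * ((2 * K) ^ n * nrm (rearr M' f))"
    using Suc K by (intro mult_left_mono) auto
  finally show ?case using mem_dilate(1)[OF f(1,2) _ IH] by (simp add: mult.assoc)
qed (use f in simp)

section \<open>The transferred quasi-norm: triangle inequality and completeness\<close>

abbreviation tmem :: "('a \<Rightarrow> real) \<Rightarrow> bool"
  where "tmem f \<equiv> ae_class M f \<in> transfer_space M E"
abbreviation tnrm :: "('a \<Rightarrow> real) \<Rightarrow> real"
  where "tnrm f \<equiv> transfer_norm M N (ae_class M f)"

lemma tmem_measurable: "tmem f \<Longrightarrow> f \<in> borel_measurable M"
  using ae_class_in_L0_iff[of M f] by (simp add: transfer_space_def)

lemma tmemI:
  assumes "f \<in> borel_measurable M" "fin_rearr M f" "mem (rearr M f)"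
  shows "tmem f" "tnrm f = nrm (rearr M f)"
  using assms rearr_class_ae_class[OF assms(1,2) refl]
  by (simp_all add: transfer_space_def transfer_norm_def ae_class_in_L0_iff)

text \<open>Without \<open>fin_rearr\<close> the rearrangement is infinite everywhere, so no real
  function represents it unless the space is null; but then the total measure is infinite.\<close>

lemma tmemD:
  assumes "tmem f"
  shows "fin_rearr M f" "mem (rearr M f)" "tnrm f = nrm (rearr M f)"
proof -
  note f = tmem_measurable[OF assms]
  show fin: "fin_rearr M f"
  proof (rule ccontr)
    assume nofin: "\<not> fin_rearr M f"
    then have total: "emeasure M (space M) = \<infinity>"
      using distr_fun_le_space[of M f 0] by (auto simp: fin_rearr_def less_top[symmetric] top_unique)
    have "rearr_class M (ae_class M f) \<in> L0 (std_space M)"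
      using assms subspace by (auto simp: transfer_space_def L0_subspace_def)
    then obtain g where g: "g \<in> borel_measurable (std_space M)"
      "rearr_class M (ae_class M f) = ae_class (std_space M) g" by (rule L0_E)
    then have "g \<in> rearr_class M (ae_class M f)" by (simp add: ae_class_def ae_eq_def)
    then obtain f' where f': "f' \<in> ae_class M f" "AE t in std_space M. ereal (g t) = rearrangement M f' t"
      by (auto simp: rearr_class_def)
    then have eq: "distr_fun M f' y = distr_fun M f y" for y
      by (intro distr_fun_cong_AE f) (auto simp: ae_class_def ae_eq_def elim: eventually_mono)
    have f'm: "f' \<in> borel_measurable M" using f' by (simp add: ae_class_def ae_eq_def)
    have "ereal z \<noteq> rearrangement M f' t" for z t
    proof
      assume z: "ereal z = rearrangement M f' t"
      then have "0 \<le> z" using rearrangement_nonneg[of M f' t] by (metis ereal_less_eq(5))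
      then have "distr_fun M f z \<le> ennreal t"
        using rearrangement_le_iff[OF f'm, of z t] z eq by simp
      then show False using nofin \<open>0 \<le> z\<close> by (auto simp: fin_rearr_def le_less_trans)
    qed
    then have "AE t in std_space M. False" using f'(2) by simp
    then have "emeasure (std_space M) (space (std_space M)) = 0"
      by (subst (asm) AE_iff_measurable[OF _ refl]) auto
    then show False using total by (simp add: emeasure_std_space_space)
  qed
  show "mem (rearr M f)" "tnrm f = nrm (rearr M f)"
    using assms rearr_class_ae_class[OF f fin refl] by (simp_all add: transfer_space_def transfer_norm_def)
qed

lemma distr_fun_rearr_tmem:
  assumes "tmem f" "0 \<le> y"
  shows "distr_fun (std_space M) (rearr M f) y = distr_fun M f y"
  using distr_fun_rearr[OF tmem_measurable tmemD(1)] assms by blast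

text \<open>Norms on \<open>M\<close> are estimated by exhibiting some \<open>h\<close> on the
  standard space with a larger distribution function.\<close>

lemma tmem_dominated:
  assumes f: "f \<in> borel_measurable M" and h: "mem h"
    and le: "\<And>y. 0 \<le> y \<Longrightarrow> distr_fun M f y \<le> distr_fun (std_space M) h y"
  shows "tmem f \<and> tnrm f \<le> nrm h"
  using mem_rearr_dominated[OF f refl h le] tmemI[OF f] by simp

lemma tmem_equidistr:
  assumes f: "f \<in> borel_measurable M" and h: "mem h"
    and eq: "\<And>y. 0 \<le> y \<Longrightarrow> distr_fun M f y = distr_fun (std_space M) h y"
  shows "tmem f \<and> tnrm f = nrm h"
proof -
  have f': "tmem f" using tmem_dominated[OF f h] eq by simp
  have "nrm (rearr M f) = nrm h"
    using equidistr[OF mem_measurable[OF tmemD(2)[OF f']] h] distr_fun_rearr_tmem[OF f'] eq by simp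
  then show ?thesis using f' tmemD(3) by simp
qed

lemma tmem_0: "tmem (\<lambda>x. 0)" and tnrm_0: "tnrm (\<lambda>x. 0) = 0"
  using tmem_equidistr[OF _ mem_0, of "\<lambda>x. 0"] nrm_0 by (simp_all add: distr_fun_def)

lemma tnrm_nonneg: "tmem f \<Longrightarrow> 0 \<le> tnrm f"
  by (simp add: tmemD nrm_nonneg)

lemma tnrm_eq_0:
  assumes "tmem f" "tnrm f = 0"
  shows "AE x in M. f x = 0"
proof -
  note [measurable] = tmem_measurable[OF assms(1)]
  have "AE t in std_space M. rearr M f t = 0"
    using assms tmemD by (intro nrm_eq_0) auto
  then have "distr_fun (std_space M) (rearr M f) 0 = distr_fun (std_space M) (\<lambda>t. 0) 0"
    using mem_measurable[OF tmemD(2)[OF assms(1)]] by (intro distr_fun_cong_AE) auto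
  then have "distr_fun M f 0 = 0"
    using distr_fun_rearr_tmem[OF assms(1), of 0] by (simp add: distr_fun_def)
  then show ?thesis by (subst AE_iff_measurable[OF _ refl]) (auto simp: distr_fun_def)
qed

lemma tmem_cmult:
  assumes "tmem f"
  shows "tmem (\<lambda>x. c * f x) \<and> tnrm (\<lambda>x. c * f x) = \<bar>c\<bar> * tnrm f"
proof (cases "c = 0")
  case True
  then show ?thesis by (simp add: tmem_0 tnrm_0)
next
  case False
  note [measurable] = tmem_measurable[OF assms]
  have "tmem (\<lambda>x. c * f x) \<and> tnrm (\<lambda>x. c * f x) = nrm (\<lambda>t. c * rearr M f t)"
    using False by (intro tmem_equidistr mem_cmult tmemD assms)
      (simp_all add: distr_fun_cmult distr_fun_rearr_tmem[OF assms])
  then show ?thesis using nrm_cmult[OF tmemD(2)[OF assms]] tmemD(3)[OF assms] by simp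
qed

text \<open>If \<open>c\<^sub>k\<close> sums to at most 1 and \<open>\<Sum> f\<^sub>k\<^sup>*(c\<^sub>k t) \<le> y\<close>, then \<open>\<Sum> |f\<^sub>k| > y\<close> forces \<open>|f\<^sub>k| > f\<^sub>k\<^sup>*(c\<^sub>k t)\<close>
  for some \<open>k\<close>, which has measure at most \<open>c\<^sub>k t\<close>. So the rearrangement of \<open>\<Sum> |f\<^sub>k|\<close> at \<open>t\<close> is at most
  \<open>\<Sum> f\<^sub>k\<^sup>*(c\<^sub>k t)\<close>; here \<open>c\<^sub>k = (7/8)\<^bsup>6(k+1)\<^esup> \<le> 2\<^bsup>-(k+1)\<^esup>\<close>.\<close>

lemma tmem_series_dominated:
  assumes f: "\<And>k. tmem (f k)" and nrm: "\<And>k. tnrm (f k) \<le> d / ((2 * K) ^ 7) ^ Suc k"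
  obtains h where "mem h" "nrm h \<le> K * d" "\<And>y. 0 \<le> y \<Longrightarrow>
    emeasure M {\<omega> \<in> space M. ennreal y < (\<Sum>k. ennreal \<bar>f k \<omega>\<bar>)} \<le> distr_fun (std_space M) h y"
proof -
  have [measurable]: "f k \<in> borel_measurable M" for k by (rule tmem_measurable[OF f])
  define c :: "nat \<Rightarrow> real" where "c k = (7 / 8) ^ (6 * Suc k)" for k
  define g where "g k t = rearr M (f k) (c k * t)" for k t
  have c: "0 < c k" "c k \<le> (1 / 2) ^ Suc k" for k
  proof -
    have "((7 / 8 :: real) ^ 6) ^ Suc k \<le> (1 / 2) ^ Suc k"
      by (rule power_mono) (simp_all add: power_divide)
    then show "c k \<le> (1 / 2) ^ Suc k" unfolding c_def power_mult .
  qed (simp add: c_def)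
  have g: "mem (g k) \<and> nrm (g k) \<le> d / (2 * K) ^ Suc k" for k
  proof -
    have "mem (g k)" "nrm (g k) \<le> (2 * K) ^ (6 * Suc k) * nrm (rearr M (f k))"
      using mem_dilate_power[OF tmem_measurable[OF f] tmemD(1,2)[OF f], of k "6 * Suc k"]
      unfolding g_def[abs_def] c_def by blast+
    moreover have "(2 * K) ^ (6 * Suc k) * nrm (rearr M (f k))
        \<le> (2 * K) ^ (6 * Suc k) * (d / ((2 * K) ^ 7) ^ Suc k)"
      using nrm[of k] tmemD(3)[OF f[of k]] K by (intro mult_left_mono) auto
    moreover have "((2 * K) ^ 7) ^ Suc k = (2 * K) ^ (6 * Suc k) * (2 * K) ^ Suc k"
      unfolding power_mult[symmetric] power_add[symmetric] by simp
    moreover have "(2 * K) ^ (6 * Suc k) \<noteq> 0" using K by simp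
    ultimately show ?thesis by (simp del: power_Suc mult_Suc_right)
  qed
  obtain h where h: "mem h" "nrm h \<le> K * d" "AE t in std_space M. \<forall>n. (\<Sum>k<n. g k t) \<le> h t"
    by (rule riesz_fischer[of g d]) (use g in \<open>auto simp: g_def rearr_nonneg\<close>)
  note [measurable] = mem_measurable[OF h(1)]
  have "emeasure M {\<omega> \<in> space M. ennreal y < (\<Sum>k. ennreal \<bar>f k \<omega>\<bar>)} \<le> distr_fun (std_space M) h y"
    if y: "0 \<le> y" for y
  proof -
    define v where "v = emeasure M {\<omega> \<in> space M. ennreal y < (\<Sum>k. ennreal \<bar>f k \<omega>\<bar>)}"
    have "v \<le> emeasure M (space M)" unfolding v_def by (rule emeasure_space)
    \<comment> \<open>Replaces a set in \<open>M\<close> by an initial interval of equal measure. It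
      remains to see that \<open>h t \<le> y\<close> forces
      \<open>v \<le> ennreal t\<close>.\<close>
    then have "v = emeasure (std_space M) {t \<in> std_interval M. ennreal t < v}"
      unfolding emeasure_std_lessThan by (simp add: min_absorb1)
    also have "\<dots> \<le> emeasure (std_space M) {t \<in> space (std_space M). y < \<bar>h t\<bar>}"
    proof (rule emeasure_mono_AE)
      show "AE t in std_space M. t \<in> {t \<in> std_interval M. ennreal t < v} \<longrightarrow>
          t \<in> {t \<in> space (std_space M). y < \<bar>h t\<bar>}"
        using AE_std_space_pos h(3)
      proof eventually_elim
        case (elim t)
        have "v \<le> ennreal t" if le: "h t \<le> y"
        proof -
          have "{\<omega> \<in> space M. ennreal y < (\<Sum>k. ennreal \<bar>f k \<omega>\<bar>)} \<subseteq> (\<Union>k. {\<omega> \<in> space M. g k t < \<bar>f k \<omega>\<bar>})"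
          proof (rule ccontr)
            assume "\<not> ?thesis"
            then obtain \<omega> where "ennreal y < (\<Sum>k. ennreal \<bar>f k \<omega>\<bar>)" "\<forall>k. \<not> g k t < \<bar>f k \<omega>\<bar>"
              by blast
            then have \<omega>: "ennreal y < (\<Sum>k. ennreal \<bar>f k \<omega>\<bar>)" "\<And>k. \<bar>f k \<omega>\<bar> \<le> g k t"
              by (simp_all add: not_less)
            have "(\<Sum>k. ennreal \<bar>f k \<omega>\<bar>) \<le> ennreal y"
              unfolding suminf_eq_SUP
            proof (rule SUP_least)
              fix n
              have "(\<Sum>k<n. \<bar>f k \<omega>\<bar>) \<le> (\<Sum>k<n. g k t)" by (intro sum_mono \<omega>)
              also have "\<dots> \<le> y" using elim(2) le by (metis order_trans)
              finally show "(\<Sum>k<n. ennreal \<bar>f k \<omega>\<bar>) \<le> ennreal y" by (simp add: ennreal_leI)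
            qed
            with \<omega>(1) show False by simp
          qed
          then have "v \<le> emeasure M (\<Union>k. {\<omega> \<in> space M. g k t < \<bar>f k \<omega>\<bar>})"
            unfolding v_def by (intro emeasure_mono) auto
          also have "\<dots> \<le> (\<Sum>k. distr_fun M (f k) (g k t))"
            unfolding distr_fun_def by (intro emeasure_subadditive_countably) auto
          also have "\<dots> \<le> (\<Sum>k. ennreal ((1 / 2) ^ Suc k * t))"
          proof (rule suminf_le)
            fix k
            have "distr_fun M (f k) (g k t) \<le> ennreal (c k * t)"
              unfolding g_def
              using rearr_le_iff[OF tmem_measurable[OF f] tmemD(1)[OF f] mult_pos_pos[OF c(1) elim(1)] rearr_nonneg]
              by (rule iffD1) (rule order_refl)
            also have "\<dots> \<le> ennreal ((1 / 2) ^ Suc k * t)"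
              using c(2)[of k] elim(1) by (intro ennreal_leI mult_right_mono) auto
            finally show "distr_fun M (f k) (g k t) \<le> ennreal ((1 / 2) ^ Suc k * t)" .
          qed auto
          also have "\<dots> = ennreal t"
            using sums_mult2[OF power_half_series, of t] elim(1) by (intro suminf_ennreal_eq) auto
          finally show ?thesis .
        qed
        then show ?case by (force simp: space_std_space not_le[symmetric])
      qed
    qed auto
    finally show ?thesis by (simp add: v_def distr_fun_def)
  qed
  with h(1,2) show thesis by (rule that)
qed

text \<open>The distribution function of \<open>h\<close> tends to 0, which gives convergence almost
  everywhere and with it the limit in the completeness proof. The bound for an arbitrary dominated
  \<open>u\<close> serves both two-term sums and tails of series.\<close>

lemma tmem_series:
  assumes f: "\<And>k. tmem (f k)" and nrm: "\<And>k. tnrm (f k) \<le> d / ((2 * K) ^ 7) ^ Suc k"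
  shows "AE \<omega> in M. (\<Sum>k. ennreal \<bar>f k \<omega>\<bar>) \<noteq> \<infinity>"
    and "u \<in> borel_measurable M \<Longrightarrow> AE \<omega> in M. ennreal \<bar>u \<omega>\<bar> \<le> (\<Sum>k. ennreal \<bar>f k \<omega>\<bar>) \<Longrightarrow>
      tmem u \<and> tnrm u \<le> K * d"
proof -
  have [measurable]: "f k \<in> borel_measurable M" for k by (rule tmem_measurable[OF f])
  let ?F = "\<lambda>\<omega>. (\<Sum>k. ennreal \<bar>f k \<omega>\<bar>)"
  obtain h where h: "mem h" "nrm h \<le> K * d"
    "\<And>y. 0 \<le> y \<Longrightarrow> emeasure M {\<omega> \<in> space M. ennreal y < ?F \<omega>} \<le> distr_fun (std_space M) h y"
    using tmem_series_dominated[of f d, OF f nrm] by blast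
  have "emeasure M {\<omega> \<in> space M. ?F \<omega> = \<infinity>} \<le> 0"
  proof (rule LIMSEQ_le_const)
    show "(\<lambda>n. distr_fun (std_space M) h (real n)) \<longlonglongrightarrow> 0"
      by (rule distr_fun_tendsto_0[OF mem_measurable mem_fin_rearr, OF h(1) h(1)])
    have "emeasure M {\<omega> \<in> space M. ?F \<omega> = \<infinity>} \<le> distr_fun (std_space M) h (real n)" for n
      by (rule order_trans[OF emeasure_mono h(3)]) auto
    then show "\<exists>N. \<forall>n\<ge>N. emeasure M {\<omega> \<in> space M. ?F \<omega> = \<infinity>} \<le> distr_fun (std_space M) h (real n)"
      by blast
  qed
  then show "AE \<omega> in M. ?F \<omega> \<noteq> \<infinity>" by (subst AE_iff_measurable[OF _ refl]) auto
  assume u [measurable]: "u \<in> borel_measurable M" and ae: "AE \<omega> in M. ennreal \<bar>u \<omega>\<bar> \<le> ?F \<omega>"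
  have "distr_fun M u y \<le> distr_fun (std_space M) h y" if y: "0 \<le> y" for y
  proof -
    have "distr_fun M u y \<le> emeasure M {\<omega> \<in> space M. ennreal y < ?F \<omega>}"
      unfolding distr_fun_def
    proof (rule emeasure_mono_AE)
      show "AE \<omega> in M. \<omega> \<in> {\<omega> \<in> space M. y < \<bar>u \<omega>\<bar>} \<longrightarrow> \<omega> \<in> {\<omega> \<in> space M. ennreal y < ?F \<omega>}"
        using ae
      proof eventually_elim
        case (elim \<omega>)
        have "ennreal y < ennreal \<bar>u \<omega>\<bar>" if "y < \<bar>u \<omega>\<bar>" using that y by (simp add: ennreal_less_iff)
        then show ?case using elim by (auto intro: less_le_trans)
      qed
    qed measurable
    then show ?thesis using h(3)[OF y] by (rule order_trans)
  qed
  then show "tmem u \<and> tnrm u \<le> K * d" using tmem_dominated[OF u h(1)] h(2) by fastforce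
qed

lemma tmem_add:
  assumes f: "tmem f" and g: "tmem g"
  shows "tmem (\<lambda>x. f x + g x) \<and>
    tnrm (\<lambda>x. f x + g x) \<le> K * ((2 * K) ^ 7) ^ 2 * (tnrm f + tnrm g)"
proof -
  note [measurable] = tmem_measurable[OF f] tmem_measurable[OF g]
  define Q where "Q = (2 * K) ^ 7"
  have Q: "1 \<le> Q" unfolding Q_def using K by (intro one_le_power) simp
  define s where "s k = (if k = 0 then f else if k = Suc 0 then g else (\<lambda>x. 0))" for k :: nat
  have s: "tmem (s k)" for k using f g tmem_0 by (simp add: s_def)
  \<comment> \<open>At index 1 the required decay is already \<open>Q ^ 2\<close>; hence this square
    in the final constant.\<close>
  have ns: "tnrm (s k) \<le> Q ^ 2 * (tnrm f + tnrm g) / Q ^ Suc k" for k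
  proof -
    have nn: "0 \<le> tnrm f" "0 \<le> tnrm g" using f g by (simp_all add: tnrm_nonneg)
    consider "k = 0" | "k = 1" | "k \<noteq> 0 \<and> k \<noteq> 1" by blast
    then show ?thesis
    proof cases
      case 1
      have "1 * tnrm f \<le> Q * (tnrm f + tnrm g)" using nn Q by (intro mult_mono) auto
      then show ?thesis using 1 Q by (simp add: s_def power2_eq_square)
    next
      case 2
      then show ?thesis using Q nn by (simp add: s_def power2_eq_square)
    next
      case 3
      then show ?thesis using Q nn by (simp add: s_def tnrm_0 del: power_Suc)
    qed
  qed
  have le: "ennreal \<bar>f x + g x\<bar> \<le> (\<Sum>k. ennreal \<bar>s k x\<bar>)" for x
  proof -
    have "ennreal \<bar>f x + g x\<bar> \<le> ennreal \<bar>f x\<bar> + ennreal \<bar>g x\<bar>"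
      by (simp add: ennreal_plus[symmetric] ennreal_leI del: ennreal_plus)
    also have "\<dots> = (\<Sum>k<2. ennreal \<bar>s k x\<bar>)" by (simp add: numeral_2_eq_2 s_def)
    also have "\<dots> \<le> (\<Sum>k. ennreal \<bar>s k x\<bar>)" by (intro sum_le_suminf) auto
    finally show ?thesis .
  qed
  note ns' = ns[unfolded Q_def]
  have "tmem (\<lambda>x. f x + g x) \<and> tnrm (\<lambda>x. f x + g x) \<le> K * (Q ^ 2 * (tnrm f + tnrm g))"
    unfolding Q_def using le by (intro tmem_series(2)[of s, OF s ns'] AE_I2) auto
  then show ?thesis by (simp only: Q_def mult.assoc)
qed

lemma tmem_diff: "tmem f \<Longrightarrow> tmem g \<Longrightarrow> tmem (\<lambda>x. f x - g x)"
  using tmem_add[of f "\<lambda>x. -1 * g x"] tmem_cmult[of g "-1"] by simp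

lemma tnrm_minus_commute: "tmem f \<Longrightarrow> tmem g \<Longrightarrow> tnrm (\<lambda>x. f x - g x) = tnrm (\<lambda>x. g x - f x)"
  using tmem_cmult[of "\<lambda>x. f x - g x" "-1"] tmem_diff[of f g] by simp

text \<open>A subsequence with geometrically small increments has an absolutely convergent
  telescoping series almost everywhere. The limit is its sum, and \<open>tmem_series\<close> applied
  to the shifted series bounds the remainder.\<close>

lemma tmem_complete: "complete_on M (transfer_space M E) (transfer_norm M N)"
  unfolding complete_on_def
proof (intro allI impI)
  fix u :: "nat \<Rightarrow> 'a \<Rightarrow> real"
  assume "\<forall>n. tmem (u n)"
  then have u: "tmem (u n)" for n by blast
  assume cauchy: "\<forall>e>0. \<exists>k. \<forall>m\<ge>k. \<forall>n\<ge>k. tnrm (\<lambda>x. u m x - u n x) < e"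
  note [measurable] = tmem_measurable[OF u]
  define Q where "Q = (2 * K) ^ 7"
  define K' where "K' = K * Q ^ 2"
  have Q: "1 < Q" unfolding Q_def using K by (intro one_less_power) auto
  have "1 \<le> K * Q ^ 2" using K Q mult_mono[of 1 K 1 "Q ^ 2"] by (simp add: one_le_power)
  then have K': "1 \<le> K'" by (simp add: K'_def)
  have "\<exists>k. \<forall>m\<ge>k. \<forall>n\<ge>k. tnrm (\<lambda>x. u m x - u n x) < 1 / Q ^ Suc j" for j
    using cauchy Q by simp
  then obtain p where p: "\<And>j m n. p j \<le> m \<Longrightarrow> p j \<le> n \<Longrightarrow> tnrm (\<lambda>x. u m x - u n x) < 1 / Q ^ Suc j"
    by metis
  \<comment> \<open>Summing makes the indices monotone while keeping them above \<open>p j\<close>;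
    repeated indices do no harm.\<close>
  define r where "r j = (\<Sum>i\<le>j. p i)" for j
  have pr: "p j \<le> r j" for j unfolding r_def by (rule member_le_sum) auto
  have r_Suc: "r j \<le> r (Suc j)" for j by (simp add: r_def)
  define f where "f k x = u (r (Suc k)) x - u (r k) x" for k x
  have f: "tmem (f k)" for k unfolding f_def[abs_def] by (intro tmem_diff u)
  note [measurable] = tmem_measurable[OF f]
  have nf: "tnrm (f k) \<le> 1 / Q ^ Suc k" for k
    unfolding f_def[abs_def] by (intro less_imp_le p order_trans[OF pr] r_Suc order_refl)
  have fin: "AE x in M. (\<Sum>k. ennreal \<bar>f k x\<bar>) \<noteq> \<infinity>"
    using nf by (intro tmem_series(1)[of f 1, OF f]) (simp add: Q_def)
  \<comment> \<open>Where the series diverges the value is arbitrary; by \<open>fin\<close> this is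
    a null set.\<close>
  define v where "v x = u (r 0) x + (\<Sum>k. f k x)" for x
  have [measurable]: "v \<in> borel_measurable M" unfolding v_def[abs_def] by measurable
  \<comment> \<open>Shifting by \<open>j\<close> divides the admissible \<open>d\<close> by
    \<open>Q ^ j\<close>.\<close>
  have tail: "tmem (\<lambda>x. v x - u (r j) x) \<and> tnrm (\<lambda>x. v x - u (r j) x) \<le> K * (1 / Q ^ j)" for j
  proof (rule tmem_series(2)[of "\<lambda>i. f (i + j)"])
    show "tnrm (f (k + j)) \<le> 1 / Q ^ j / ((2 * K) ^ 7) ^ Suc k" for k
      using nf[of "k + j"] by (simp add: Q_def power_add mult_ac)
    show "AE x in M. ennreal \<bar>v x - u (r j) x\<bar> \<le> (\<Sum>i. ennreal \<bar>f (i + j) x\<bar>)"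
      using fin
    proof eventually_elim
      case (elim x)
      then have summ: "summable (\<lambda>k. \<bar>f k x\<bar>)" by (intro summable_suminf_not_top) auto
      then have summ': "summable (\<lambda>i. \<bar>f (i + j) x\<bar>)" by (rule summable_ignore_initial_segment)
      have "(\<Sum>k<j. f k x) = u (r j) x - u (r 0) x"
        unfolding f_def by (rule sum_lessThan_telescope)
      then have "v x - u (r j) x = (\<Sum>i. f (i + j) x)"
        using suminf_minus_initial_segment[OF summable_rabs_cancel[OF summ], of j] by (simp add: v_def)
      then have "\<bar>v x - u (r j) x\<bar> \<le> (\<Sum>i. \<bar>f (i + j) x\<bar>)"
        using summable_rabs[OF summ'] by simp
      then show ?case using summ' by (subst suminf_ennreal2) (auto intro: ennreal_leI)
    qed
  qed (use f in auto)
  have v: "tmem v" using tmem_add[OF conjunct1[OF tail] u, of 0 "r 0"] by simp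
  have "(\<lambda>n. tnrm (\<lambda>x. u n x - v x)) \<longlonglongrightarrow> 0"
  proof (rule LIMSEQ_I)
    fix e :: real assume e: "0 < e"
    have "(\<lambda>j. K' * (1 + K) / Q ^ j) \<longlonglongrightarrow> 0" by (rule LIMSEQ_divide_realpow_zero[OF Q])
    then obtain j where j: "K' * (1 + K) / Q ^ j < e"
      using order_tendstoD(2)[OF _ e] by (metis (no_types, lifting) eventually_sequentially order_refl)
    have "norm (tnrm (\<lambda>x. u n x - v x) - 0) < e" if n: "r j \<le> n" for n
    proof -
      have "tnrm (\<lambda>x. (u n x - u (r j) x) + (u (r j) x - v x))
          \<le> K' * (tnrm (\<lambda>x. u n x - u (r j) x) + tnrm (\<lambda>x. u (r j) x - v x))"
        unfolding K'_def Q_def by (intro conjunct2[OF tmem_add] tmem_diff u v)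
      also have "\<dots> \<le> K' * (1 / Q ^ j + K * (1 / Q ^ j))"
      proof (intro mult_left_mono add_mono)
        have "tnrm (\<lambda>x. u n x - u (r j) x) < 1 / Q ^ Suc j"
          using n by (intro p order_trans[OF pr]) auto
        also have "\<dots> \<le> 1 / Q ^ j" using Q by (intro divide_left_mono power_increasing) auto
        finally show "tnrm (\<lambda>x. u n x - u (r j) x) \<le> 1 / Q ^ j" by simp
        show "tnrm (\<lambda>x. u (r j) x - v x) \<le> K * (1 / Q ^ j)"
          using tail[of j] tnrm_minus_commute[OF u v, of "r j"] by simp
      qed (use K' in simp)
      also have "\<dots> = K' * (1 + K) / Q ^ j" by (simp add: algebra_simps add_divide_distrib)
      finally show ?thesis using j tnrm_nonneg[OF tmem_diff[OF u v], of n] by simp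
    qed
    then show "\<exists>n0. \<forall>n\<ge>n0. norm (tnrm (\<lambda>x. u n x - v x) - 0) < e" by blast
  qed
  with v show "\<exists>v. tmem v \<and> (\<lambda>n. tnrm (\<lambda>x. u n x - v x)) \<longlonglongrightarrow> 0" by blast
qed

text \<open>The passage back from the interval, where nonatomicity enters. It yields both
  nontriviality and one inclusion between the \<open>Xi\<close>.\<close>

lemma ex_tmem_equidistr:
  assumes "nonatomic M" and h: "mem h"
  obtains f where "tmem f" "tnrm f = nrm h" "rearr M f = rearr (std_space M) h"
proof -
  obtain f where f: "f \<in> borel_measurable M"
    "\<And>y. 0 \<le> y \<Longrightarrow> distr_fun M f y = distr_fun (std_space M) h y"
    using ex_distr_fun_eq[OF assms(1) mem_measurable[OF h] mem_fin_rearr[OF h] emeasure_std_space_space] by blast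
  then show thesis
    using tmem_equidistr[OF f(1) h] rearrangement_cong[of M f "std_space M" h]
    by (intro that[of f]) (auto simp: rearr_def[abs_def])
qed

lemma symm_space_transfer:
  assumes "nonatomic M"
  shows "symm_space M (transfer_space M E) (transfer_norm M N) (K * ((2 * K) ^ 7) ^ 2)"
proof
  have "1 \<le> ((2 * K) ^ 7) ^ 2" using K by (intro one_le_power) simp
  then show "1 \<le> K * ((2 * K) ^ 7) ^ 2" using K mult_mono[of 1 K 1 "((2 * K) ^ 7) ^ 2"] by simp
  show "L0_subspace M (transfer_space M E)"
    unfolding L0_subspace_def using tmem_0 tmem_add tmem_cmult by (auto simp: transfer_space_def)
  show "quasi_norm_on M (transfer_space M E) (transfer_norm M N) (K * ((2 * K) ^ 7) ^ 2)"
    unfolding quasi_norm_on_def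
  proof (intro conjI ballI allI impI)
    fix A assume A: "A \<in> transfer_space M E"
    then have "A \<in> L0 M" by (simp add: transfer_space_def)
    then obtain f where f: "A = ae_class M f" by (rule L0_E)
    then have tf: "tmem f" using A by simp
    show "0 \<le> transfer_norm M N A" using tnrm_nonneg[OF tf] f by simp
    show "transfer_norm M N A = 0 \<longleftrightarrow> A = ae_class M (\<lambda>x. 0)"
      using tnrm_eq_0[OF tf] ae_class_eq_iff[OF tmem_measurable[OF tf], of "\<lambda>x. 0"] tnrm_0 f by auto
  qed (use tmem_add tmem_cmult in auto)
  show "complete_on M (transfer_space M E) (transfer_norm M N)" by (rule tmem_complete)
  show "transfer_space M E \<noteq> {ae_class M (\<lambda>x. 0)}"
  proof
    assume triv: "transfer_space M E = {ae_class M (\<lambda>x. 0)}"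
    \<comment> \<open>A nonzero element of \<open>E\<close> has an equidistributed counterpart on
      \<open>M\<close> with the same norm, which triviality would make 0.\<close>
    obtain A where A: "A \<in> E" "A \<noteq> ae_class (std_space M) (\<lambda>x. 0)"
      using nontrivial mem_0 by blast
    then have "A \<in> L0 (std_space M)" using subspace by (auto simp: L0_subspace_def)
    then obtain h where h: "A = ae_class (std_space M) h" by (rule L0_E)
    then obtain f where "tmem f" "tnrm f = nrm h" using ex_tmem_equidistr[OF assms] A by metis
    then have "nrm h = 0" using triv tnrm_0 by simp
    then show False using A h quasi_norm by (simp add: quasi_norm_on_def)
  qed
next
  fix f g assume f: "f \<in> borel_measurable M" and g: "tmem g" and ae: "AE x in M. \<bar>f x\<bar> \<le> \<bar>g x\<bar>"
  show "tmem f \<and> tnrm f \<le> tnrm g"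
    unfolding tmemD(3)[OF g]
    by (intro tmem_dominated f tmemD(2) g) (simp add: distr_fun_rearr_tmem[OF g] distr_fun_mono_AE f tmem_measurable[OF g] ae)
next
  fix f g assume f: "f \<in> borel_measurable M" and g: "tmem g"
    and eq: "\<And>x. 0 \<le> x \<Longrightarrow> distr_fun M f x = distr_fun M g x"
  show "tmem f \<and> tnrm f = tnrm g"
    unfolding tmemD(3)[OF g]
    by (intro tmem_equidistr f tmemD(2) g) (simp add: distr_fun_rearr_tmem[OF g] eq)
qed

section \<open>Strict equimeasurability\<close>

lemma rearr_class_mem:
  assumes h: "mem h"
  shows "rearr_class (std_space M) (ae_class (std_space M) h) = ae_class (std_space M) (rearr (std_space M) h)"
    "mem (rearr (std_space M) h)" "nrm (rearr (std_space M) h) = nrm h"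
proof -
  note hm = mem_measurable[OF h] and fin = mem_fin_rearr[OF h]
  show "rearr_class (std_space M) (ae_class (std_space M) h) = ae_class (std_space M) (rearr (std_space M) h)"
    by (rule rearr_class_ae_class[OF hm fin std_space_idem])
  show "mem (rearr (std_space M) h)" "nrm (rearr (std_space M) h) = nrm h"
    using equidistr[OF _ h, of "rearr (std_space M) h"] rearr_measurable[OF hm, of 1]
    by (simp_all add: distr_fun_rearr[OF hm fin] emeasure_std_space_space)
qed

text \<open>Makes the definite description in \<open>Xi_norm\<close> well defined on the standard
  space: the norm is read off from the rearrangement.\<close>

lemma norm_rearr_class:
  assumes "A \<in> E"
  shows "N (rearr_class (std_space M) A) = N A"
proof -
  have "A \<in> L0 (std_space M)" using assms subspace by (auto simp: L0_subspace_def)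
  then obtain h where "A = ae_class (std_space M) h" by (rule L0_E)
  then show ?thesis using rearr_class_mem[of h] assms by simp
qed

text \<open>Towards \<open>M\<close>, an equidistributed function is the counterpart. Towards the
  interval, \<open>rearr M f\<close> itself serves, since rearranging it again changes
  nothing.\<close>

lemma Xi_transfer:
  assumes "nonatomic M"
  shows "Xi (std_space M) E = Xi M (transfer_space M E)"
proof -
  have "rearr_class (std_space M) ` E = rearr_class M ` transfer_space M E"
  proof safe
    fix A assume A: "A \<in> E"
    then have "A \<in> L0 (std_space M)" using subspace by (auto simp: L0_subspace_def)
    then obtain h where h: "A = ae_class (std_space M) h" by (rule L0_E)
    then obtain f where f: "tmem f" "rearr M f = rearr (std_space M) h"
      using ex_tmem_equidistr[OF assms] A by metis
    then have "rearr_class M (ae_class M f) = rearr_class (std_space M) A"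
      using A by (simp add: h rearr_class_mem(1) rearr_class_ae_class[OF tmem_measurable tmemD(1) refl])
    then show "rearr_class (std_space M) A \<in> rearr_class M ` transfer_space M E" using f(1) by force
  next
    fix A assume A: "A \<in> transfer_space M E"
    then have "A \<in> L0 M" by (simp add: transfer_space_def)
    then obtain f where f: "A = ae_class M f" by (rule L0_E)
    then have tf: "tmem f" using A by simp
    have "rearrangement (std_space M) (rearr M f) = rearrangement M f"
      by (intro rearrangement_cong distr_fun_rearr_tmem tf)
    then have "rearr (std_space M) (rearr M f) = rearr M f" by (simp add: rearr_def[abs_def])
    then have "rearr_class (std_space M) (ae_class (std_space M) (rearr M f)) = rearr_class M A"
      using rearr_class_mem(1)[OF tmemD(2)[OF tf]]
        rearr_class_ae_class[OF tmem_measurable tmemD(1) refl, OF tf tf] by (simp add: f)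
    then show "rearr_class M A \<in> rearr_class (std_space M) ` E" using tmemD(2)[OF tf] by force
  qed
  then show ?thesis by (simp add: Xi_def std_space_idem)
qed

text \<open>Both norms on the common \<open>Xi\<close> are the restriction of \<open>N\<close>: by
  \<open>norm_rearr_class\<close> on the interval and by the definition of
  \<open>transfer_norm\<close> on \<open>M\<close>.\<close>

lemma strictly_equimeasurable_transfer:
  assumes "nonatomic M"
  shows "strictly_equimeasurable (std_space M) E N M (transfer_space M E) (transfer_norm M N)"
  unfolding strictly_equimeasurable_def equimeasurable_def
proof (intro conjI ballI)
  fix h assume h: "h \<in> Xi (std_space M) E"
  then obtain A where "A \<in> E" "rearr_class (std_space M) A = h" by (auto simp: Xi_def)
  then have "Xi_norm (std_space M) E N h = N h"
    unfolding Xi_norm_def by (intro the_equality) (metis norm_rearr_class)+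
  moreover have "h \<in> Xi M (transfer_space M E)" using h Xi_transfer[OF assms] by simp
  then obtain B where "B \<in> transfer_space M E" "rearr_class M B = h" by (auto simp: Xi_def)
  then have "Xi_norm M (transfer_space M E) (transfer_norm M N) h = N h"
    unfolding Xi_norm_def transfer_norm_def by (intro the_equality) auto
  ultimately show "Xi_norm (std_space M) E N h = Xi_norm M (transfer_space M E) (transfer_norm M N) h"
    by simp
qed (rule Xi_transfer[OF assms])

end

theorem theorem1:
  fixes M :: "'a measure"
    and E :: "(real \<Rightarrow> real) set set"
    and N :: "(real \<Rightarrow> real) set \<Rightarrow> real"
  assumes "complete_measure M"
    and "sigma_finite_measure M"
    and "nonatomic M"
    and "0 < emeasure M (space M)"
    and "symmetric_space (std_space M) E N"
  shows "symmetric_space M (transfer_space M E) (transfer_norm M N) \<and>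
    strictly_equimeasurable (std_space M) E N M (transfer_space M E) (transfer_norm M N)"
proof -
  obtain K where "symm_space (std_space M) E N K"
    using assms(5) by (auto simp: symmetric_space_iff)
  then interpret std_symm_space M E N K by (simp add: std_symm_space_def)
  show ?thesis
    using symm_space_transfer[OF assms(3)] strictly_equimeasurable_transfer[OF assms(3)]
    by (auto simp: symmetric_space_iff)
qed

end
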